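(* Let $d,n\ge 1$ be integers and let $X=(X_1,\dots,X_d)$ be a random vector with independent components, where $X_j$ has law $\mu_j$, a Borel probability measure absolutely continuous with respect to Lebesgue measure, with continuous density $\rho_j$ taking strictly positive values on its open support $\Omega_j\subseteq\mathbb R$, and cumulative distribution function $F_j$. Put $\Omega=\Omega_1\times\dots\times\Omega_d$ and $\mu=\mu_1\otimes\dots\otimes\mu_d$. Let $f:\mathbb R^d\to\mathbb R^n$ be a function each of whose components is Borel measurable and differentiable with respect to $x_v$ for every $v\subseteq\{1,\dots,d\}$, with $\mathbb E\|f(X)\|^2<+\infty$, and such that for every $v\subseteq\{1,\dots,d\}$ the function $\frac{\partial^{|v|}f}{\partial x_v}$ is measurable with $\mathbb E\left\|\frac{\partial^{|v|}f}{\partial x_v}(X)\right\|^2<+\infty$. For $j\in\{1,\dots,d\}$ put $$D_j=\int_\Omega\frac{\partial f}{\partial x_j}(x)\,\frac{\partial f^{T}}{\partial x_j}(x)\,\frac{F_j(x_j)(1-F_j(x_j))}{[\rho_j(x_j)]^2}\,d\mu(x).$$ Then: (i) $$\mathrm{Var}_\mu(f)\preceq\sum_{u\subseteq\{1,\dots,d\},\,|u|>0}\frac1{2^{|u|}}\int_\Omega\frac{\partial^{|u|}f}{\partial x_u}(x)\,\frac{\partial^{|u|}f^{T}}{\partial x_u}(x)\prod_{k\in u}\frac{F_k(x_k)(1-F_k(x_k))}{[\rho_k(x_k)]^2}\,d\mu(x).$$ (ii) If there exists a nonempty $J_0\subseteq\{1,\dots,d\}$ such that $\int_{\Omega_j}f\,d\mu_j=\mathbf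 0$ for all $j\in J_0$, then $$\mathrm{Var}_\mu(f)\preceq\frac12 D_{(1)},\qquad\text{where } (1)=\arg\min_{j\in J_0}D_j .$$ (iii) If the theoretical interaction super-set $\mathcal A_j$ of $X_j$ is known for all $j\in\{1,\dots,d\}$, then $$\mathrm{Var}_\mu(f)\preceq\sum_{j=1}^d\frac{\left|\mathcal A_{(j)}\setminus\bigcup_{i\in\{(1),\dots,(j-1)\}}\mathcal A_i\right|}{2}\,D_{(j)},$$ where the indices $(1),(2),\dots,(d)$ are defined successively by $(j)=\arg\min_{k\in\{1,\dots,d\}\setminus\{(1),\dots,(j-1)\}}D_k$, and $|\cdot|$ denotes cardinality.
   Context: For $v\subseteq\{1,\dots,d\}$: $x_v=(x_j)_{j\in v}$; $\frac{\partial^{|v|}}{\partial x_v}:=\prod_{j\in v}\frac{\partial}{\partial x_j}$ is the cross-partial derivative (once in each $x_j$, $j\in v$), applied to each component of $f$; $f$ is "differentiable with respect to $x_v$" if it exists. The theoretical interaction super-set of $X_j$ is $$\mathcal A_j:=\left\{\{j\}\cup u:\ u\subseteq\{1,\dots,d\}\setminus\{j\},\ \frac{\partial^{|u|+1}f}{\partial x_{\{j\}\cup u}}\ne\mathbf 0\right\},$$ where $\ne\mathbf 0$ means "is not identically zero" and $u=\emptyset$ is allowed. Vectors in $\mathbb R^n$ are columns, $T$ is transpose, $\|\cdot\|$ is the Euclidean norm, $\mathrm{Var}_\mu(g)=\int_\Omega gg^{T}d\mu-\int_\Omega g\,d\mu\int_\Omega g^{T}d\mu$. $\Sigma_1\preceq\Sigma_2$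 (Loewner order) means $\Sigma_2-\Sigma_1$ is positive semi-definite. The minimizers of the matrices $D_j$ are understood with respect to the Loewner order (ties broken arbitrarily).
   Formalization: Each open support Ω_j is assumed to be an interval (possibly unbounded); for a support with a gap the claim is false, e.g. X uniform on (0,1)∪(2,3) and f smooth, 0 for x≤1 and 1 for x≥2, where Var=1/4 but the bound is 0. *)

theory Defs
  imports "HOL-Probability.Probability"
begin

definition upd_coord :: "real ^ 'd \<Rightarrow> 'd \<Rightarrow> real \<Rightarrow> real ^ 'd" where
  "upd_coord x j t = (\<chi> i. if i = j then t else x $ i)"

text \<open>
  \<open>has_cross_partial f v g\<close>: differentiating \<open>f\<close> successively, once in each coordinate of \<open>v\<close>,
  is possible everywhere and yields \<open>g\<close>.  The coordinates may be taken in any one order; other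
  orders are not required to be possible or to give the same result.
\<close>

inductive has_cross_partial ::
    "(real ^ 'd \<Rightarrow> 'b::real_normed_vector) \<Rightarrow> 'd set \<Rightarrow> (real ^ 'd \<Rightarrow> 'b) \<Rightarrow> bool"
  for f where
  empty: "has_cross_partial f {} f"
| insert: "\<lbrakk>has_cross_partial f v g; j \<notin> v;
      \<And>x. ((\<lambda>t. g (upd_coord x j t)) has_vector_derivative h x) (at (x $ j))\<rbrakk>
    \<Longrightarrow> has_cross_partial f (insert j v) h"

definition interaction_superset :: "('d set \<Rightarrow> real ^ 'd \<Rightarrow> 'b::zero) \<Rightarrow> 'd \<Rightarrow> 'd set set" where
  "interaction_superset Df j = {insert j u | u. j \<notin> u \<and> Df (insert j u) \<noteq> (\<lambda>x. 0)}"

definition marginal :: "(real \<Rightarrow> real) \<Rightarrow> real measure" where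
  "marginal r = density lborel (\<lambda>t. ennreal (r t))"

text \<open>The product of the marginals, transported from functions \<open>'d \<Rightarrow> real\<close> to \<open>real ^ 'd\<close>.\<close>

definition prod_law :: "('d::finite \<Rightarrow> real \<Rightarrow> real) \<Rightarrow> (real ^ 'd) measure" where
  "prod_law \<rho> = distr (\<Pi>\<^sub>M j\<in>UNIV. marginal (\<rho> j)) borel (\<lambda>y. \<chi> j. y j)"

definition box_of :: "('d \<Rightarrow> real set) \<Rightarrow> (real ^ 'd) set" where
  "box_of \<Omega> = {x. \<forall>j. x $ j \<in> \<Omega> j}"

definition weight :: "(real \<Rightarrow> real) \<Rightarrow> real \<Rightarrow> real" where
  "weight r t = cdf (marginal r) t * (1 - cdf (marginal r) t) / (r t)\<^sup>2"

definition outer :: "real ^ 'n \<Rightarrow> real ^ 'n \<Rightarrow> real ^ 'n ^ 'n" where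
  "outer a b = (\<chi> i k. a $ i * b $ k)"

definition var_matrix :: "(real ^ 'd) measure \<Rightarrow> (real ^ 'd) set \<Rightarrow> (real ^ 'd \<Rightarrow> real ^ 'n)
    \<Rightarrow> real ^ 'n ^ 'n" where
  "var_matrix M S g = (LINT x:S|M. outer (g x) (g x)) - outer (LINT x:S|M. g x) (LINT x:S|M. g x)"

definition weighted_outer :: "('d::finite \<Rightarrow> real \<Rightarrow> real) \<Rightarrow> ('d set \<Rightarrow> real ^ 'd \<Rightarrow> real ^ 'n)
    \<Rightarrow> 'd set \<Rightarrow> real ^ 'd \<Rightarrow> real ^ 'n ^ 'n" where
  "weighted_outer \<rho> Df u x = (\<Prod>k\<in>u. weight (\<rho> k) (x $ k)) *\<^sub>R outer (Df u x) (Df u x)"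

text \<open>
  Not the order \<open>\<le>\<close> of the library on \<open>real ^ 'n ^ 'n\<close>, which is entrywise.
\<close>

definition psd :: "real ^ 'n ^ 'n \<Rightarrow> bool" where
  "psd A \<longleftrightarrow> transpose A = A \<and> (\<forall>c. 0 \<le> c \<bullet> (A *v c))"

definition loewner_le :: "real ^ 'n ^ 'n \<Rightarrow> real ^ 'n ^ 'n \<Rightarrow> bool"  (infix "\<preceq>\<^sub>L" 50) where
  "A \<preceq>\<^sub>L B \<longleftrightarrow> psd (B - A)"

text \<open>
  The Loewner order is partial, so an argmin is understood as a minimal element: nothing in
  the family lies strictly below it.  A least element, if there is one, is minimal.
\<close>

definition loewner_argmin :: "('k \<Rightarrow> real ^ 'n ^ 'n) \<Rightarrow> 'k set \<Rightarrow> 'k \<Rightarrow> bool" where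
  "loewner_argmin D K m \<longleftrightarrow> m \<in> K \<and> (\<forall>k\<in>K. D k \<preceq>\<^sub>L D m \<longrightarrow> D m \<preceq>\<^sub>L D k)"

text \<open>
  The integral of a positive semi-definite matrix-valued function may diverge, in which case
  the Bochner integral is the meaningless value 0.  Such an integral is identified with its
  quadratic form, which takes values in \<open>[0, \<infinity>]\<close>; the Loewner order is then the pointwise order
  \<open>\<le>\<close> of functions \<open>real ^ 'n \<Rightarrow> ennreal\<close>.
\<close>

definition quad_form :: "real ^ 'n ^ 'n \<Rightarrow> real ^ 'n \<Rightarrow> ennreal" where
  "quad_form A c = ennreal (c \<bullet> (A *v c))"

definition ext_integral_form :: "(real ^ 'd) measure \<Rightarrow> (real ^ 'd) set
    \<Rightarrow> (real ^ 'd \<Rightarrow> real ^ 'n ^ 'n) \<Rightarrow> real ^ 'n \<Rightarrow> ennreal" where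
  "ext_integral_form M S G c = (\<integral>\<^sup>+x\<in>S. quad_form (G x) c \<partial>M)"

end

theory Submission
  imports Defs
begin

text \<open>
  All three bounds come from one inequality: the variance of \<open>f\<close> is at most half the sum over the
  coordinates \<open>j\<close> of the first-order energies \<open>D j\<close>.  Testing against a vector \<open>c\<close> reduces it to the
  scalar function \<open>c \<bullet> f\<close>, for which it combines two facts.

  The first is the Efron--Stein inequality (\<open>efron_stein\<close>): under a product law the variance is at
  most the sum of the expected variances in the single coordinates.  The second is a weighted Poincare
  inequality on the line (\<open>weighted_poincare\<close>): for a law with density \<open>r\<close> and distribution function
  \<open>F\<close>, the variance of \<open>h\<close> is at most half the integral of \<open>h'\<^sup>2 F (1 - F) / r\<^sup>2\<close>.  For the latter, an
  increment of \<open>h\<close> between \<open>s < t\<close> satisfies, by Cauchy--Schwarz,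
  \<open>(h t - h s)\<^sup>2 \<le> (F t - F s) * \<integral>\<^sub>s\<^sup>t h'\<^sup>2 / r\<close>, and integrating over independent \<open>s\<close> and \<open>t\<close> on the two
  sides of a point \<open>z\<close> produces the weight \<open>F z (1 - F z) / 2\<close> (\<open>two_sided_kernel\<close>).  Both facts are
  proved for integrals with values in \<open>[0, \<infinity>]\<close>, which serves the extended quadratic forms and the
  convergent matrix integrals at the same time.

  For part (i), the first-order energies with factor \<open>1/2\<close> are the summands for singletons \<open>u\<close>, and
  the other summands are positive semi-definite.  For part (ii), if \<open>f\<close> is centred in the \<open>j\<close>-th coordinate,
  then its second moment equals the expected variance in that coordinate, and the Poincare inequality
  in this coordinate alone bounds it by \<open>D j / 2\<close>; this holds for each \<open>j\<close> in \<open>J0\<close>, hence for the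
  minimizing one.  For part (iii), the indices chosen successively exhaust all coordinates, and
  \<open>{\<sigma> j}\<close> lies in the super-set of \<open>\<sigma> j\<close> and in none of the earlier ones as soon as the partial
  derivative in \<open>\<sigma> j\<close> is not identically zero.  So each coefficient is at least \<open>1/2\<close> unless
  \<open>D (\<sigma> j)\<close> is zero.
\<close>

section \<open>Variance under product measures\<close>

text \<open>
  Twice the variance of \<open>h\<close> under a probability \<open>N\<close>, written with an independent copy.  In this form
  the quantity makes sense in \<open>[0, \<infinity>]\<close> for every measurable \<open>h\<close>, so that inequalities between
  variances can be proved by Tonelli alone; square integrability enters only when the result is
  translated back by \<open>sq_gap_eq_variance\<close>.
\<close>

definition sq_gap :: "'a measure \<Rightarrow> ('a \<Rightarrow> real) \<Rightarrow> ennreal" where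
  "sq_gap N h = (\<integral>\<^sup>+s. \<integral>\<^sup>+t. ennreal ((h s - h t)\<^sup>2) \<partial>N \<partial>N)"

lemma quadrilateral_diagonals_le_sides:
  fixes p q r s :: real
  shows "(p - s)\<^sup>2 + (q - r)\<^sup>2 \<le> (p - q)\<^sup>2 + (r - s)\<^sup>2 + ((p - r)\<^sup>2 + (q - s)\<^sup>2)"
proof -
  have "(p - q)\<^sup>2 + (r - s)\<^sup>2 + ((p - r)\<^sup>2 + (q - s)\<^sup>2) - ((p - s)\<^sup>2 + (q - r)\<^sup>2) = (p - q - r + s)\<^sup>2"
    by (simp add: power2_eq_square algebra_simps)
  moreover have "0 \<le> (p - q - r + s)\<^sup>2" by simp
  ultimately show ?thesis by linarith
qed

text \<open>
  Take independent copies \<open>a, a'\<close> and \<open>b, b'\<close>.  The four values \<open>g (a, b)\<close>, \<open>g (a', b)\<close>,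
  \<open>g (a', b')\<close>, \<open>g (a, b')\<close> are the corners of a quadrilateral whose sides change one argument and
  whose diagonals change both.  Both diagonals have the same law up to sign, and so have opposite
  sides; averaging the quadrilateral inequality gives twice the claim.
\<close>

lemma sq_gap_two_factors:
  assumes "prob_space A" and "prob_space B"
    and g [measurable]: "g \<in> borel_measurable (A \<Otimes>\<^sub>M B)"
  shows "(\<integral>\<^sup>+a. \<integral>\<^sup>+a'. \<integral>\<^sup>+b. \<integral>\<^sup>+b'. ennreal ((g (a, b) - g (a', b'))\<^sup>2) \<partial>B \<partial>B \<partial>A \<partial>A)
    \<le> (\<integral>\<^sup>+b. sq_gap A (\<lambda>a. g (a, b)) \<partial>B) + (\<integral>\<^sup>+a. sq_gap B (\<lambda>b. g (a, b)) \<partial>A)"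
    (is "?L \<le> ?U + ?W")
proof -
  interpret A: prob_space A by fact
  interpret B: prob_space B by fact
  interpret AA: pair_sigma_finite A A ..
  interpret BB: pair_sigma_finite B B ..
  interpret AB: pair_sigma_finite A B ..
  define K where "K \<phi> = (\<integral>\<^sup>+a. \<integral>\<^sup>+a'. \<integral>\<^sup>+b. \<integral>\<^sup>+b'. ennreal (\<phi> a a' b b') \<partial>B \<partial>B \<partial>A \<partial>A)"
    for \<phi> :: "_ \<Rightarrow> _ \<Rightarrow> _ \<Rightarrow> _ \<Rightarrow> real"
  have ps: "K (\<lambda>a a' b b'. (g (a, b) - g (a', b'))\<^sup>2) = ?L"
    by (simp add: K_def)
  have qr: "K (\<lambda>a a' b b'. (g (a', b) - g (a, b'))\<^sup>2) = ?L"
  proof -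
    have "(\<integral>\<^sup>+b. \<integral>\<^sup>+b'. ennreal ((g (a', b) - g (a, b'))\<^sup>2) \<partial>B \<partial>B)
        = (\<integral>\<^sup>+b. \<integral>\<^sup>+b'. ennreal ((g (a, b) - g (a', b'))\<^sup>2) \<partial>B \<partial>B)"
      if [measurable]: "a \<in> space A" "a' \<in> space A" for a a'
    proof -
      have "(\<integral>\<^sup>+b. \<integral>\<^sup>+b'. ennreal ((g (a', b) - g (a, b'))\<^sup>2) \<partial>B \<partial>B)
          = (\<integral>\<^sup>+b'. \<integral>\<^sup>+b. ennreal ((g (a', b) - g (a, b'))\<^sup>2) \<partial>B \<partial>B)"
        by (rule BB.Fubini'[symmetric]) measurable
      then show ?thesis
        by (simp add: power2_commute)
    qed
    then show ?thesis
      by (simp add: K_def cong: nn_integral_cong)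
  qed
  have U: "(\<integral>\<^sup>+a. \<integral>\<^sup>+a'. \<integral>\<^sup>+b. ennreal ((g (a, b) - g (a', b))\<^sup>2) \<partial>B \<partial>A \<partial>A) = ?U"
  proof -
    have "(\<integral>\<^sup>+a. \<integral>\<^sup>+a'. \<integral>\<^sup>+b. ennreal ((g (a, b) - g (a', b))\<^sup>2) \<partial>B \<partial>A \<partial>A)
      = (\<integral>\<^sup>+a. \<integral>\<^sup>+b. \<integral>\<^sup>+a'. ennreal ((g (a, b) - g (a', b))\<^sup>2) \<partial>A \<partial>B \<partial>A)"
      by (intro nn_integral_cong AB.Fubini'[symmetric]) measurable
    also have "\<dots> = ?U"
      unfolding sq_gap_def by (rule AB.Fubini'[symmetric]) measurable
    finally show ?thesis .
  qed
  have pq: "K (\<lambda>a a' b b'. (g (a, b) - g (a', b))\<^sup>2) = ?U"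
    using U by (simp add: K_def B.emeasure_space_1)
  have rs: "K (\<lambda>a a' b b'. (g (a, b') - g (a', b'))\<^sup>2) = ?U"
    using U by (simp add: K_def B.emeasure_space_1)
  have pr: "K (\<lambda>a a' b b'. (g (a, b) - g (a, b'))\<^sup>2) = ?W"
    by (simp add: K_def A.emeasure_space_1 sq_gap_def)
  have qs: "K (\<lambda>a a' b b'. (g (a', b) - g (a', b'))\<^sup>2) = ?W"
    by (simp add: K_def A.emeasure_space_1 sq_gap_def)
  have "2 * ?L = K (\<lambda>a a' b b'. (g (a, b) - g (a', b'))\<^sup>2) + K (\<lambda>a a' b b'. (g (a', b) - g (a, b'))\<^sup>2)"
    by (simp only: ps qr mult_2)
  also have "\<dots> = K (\<lambda>a a' b b'. (g (a, b) - g (a', b'))\<^sup>2 + (g (a', b) - g (a, b'))\<^sup>2)"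
    unfolding K_def
    by (simp add: nn_integral_add[symmetric] del: nn_integral_const cong: nn_integral_cong)
  also have "\<dots> \<le> K (\<lambda>a a' b b'. (g (a, b) - g (a', b))\<^sup>2 + (g (a, b') - g (a', b'))\<^sup>2
      + ((g (a, b) - g (a, b'))\<^sup>2 + (g (a', b) - g (a', b'))\<^sup>2))"
    unfolding K_def by (intro nn_integral_mono ennreal_leI quadrilateral_diagonals_le_sides)
  also have "\<dots> = (K (\<lambda>a a' b b'. (g (a, b) - g (a', b))\<^sup>2) + K (\<lambda>a a' b b'. (g (a, b') - g (a', b'))\<^sup>2))
      + (K (\<lambda>a a' b b'. (g (a, b) - g (a, b'))\<^sup>2) + K (\<lambda>a a' b b'. (g (a', b) - g (a', b'))\<^sup>2))"
    unfolding K_def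
    by (simp add: nn_integral_add[symmetric] del: nn_integral_const cong: nn_integral_cong)
  also have "\<dots> = (?U + ?U) + (?W + ?W)"
    by (simp only: pq rs pr qs)
  also have "\<dots> = 2 * (?U + ?W)"
    by (simp add: mult_2 algebra_simps)
  finally show ?thesis
    by (subst (asm) ennreal_mult_le_mult_iff) auto
qed

lemma measurable_upd_same:
  assumes "j \<in> J"
  shows "(\<lambda>(x, t). x(j := t)) \<in> Pi\<^sub>M J M \<Otimes>\<^sub>M M j \<rightarrow>\<^sub>M Pi\<^sub>M J M"
proof -
  have [simp]: "insert j J = J" using assms by auto
  show ?thesis
    using measurable_fun_upd[of J J j fst "Pi\<^sub>M J M \<Otimes>\<^sub>M M j" M snd]
    by (simp add: case_prod_beta')
qed

lemma (in product_sigma_finite) measurable_sq_gap_upd: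
  assumes "j \<in> J" and [measurable]: "g \<in> borel_measurable (Pi\<^sub>M J M)"
  shows "(\<lambda>x. sq_gap (M j) (\<lambda>t. g (x(j := t)))) \<in> borel_measurable (Pi\<^sub>M J M)"
proof -
  interpret sigma_finite_measure "M j" by (rule sigma_finite_measures)
  note [measurable] = measurable_upd_same[OF assms(1), of M]
  show ?thesis unfolding sq_gap_def by measurable
qed

text \<open>
  The Efron--Stein inequality: the variance is at most the sum of the expected variances in the
  single coordinates.  Each coordinate in turn is split off as the second factor of a product.
\<close>

lemma (in product_sigma_finite) efron_stein:
  assumes "finite J" and P: "\<And>i. prob_space (M i)"
    and "g \<in> borel_measurable (Pi\<^sub>M J M)"
  shows "sq_gap (Pi\<^sub>M J M) g \<le> (\<Sum>j\<in>J. \<integral>\<^sup>+x. sq_gap (M j) (\<lambda>t. g (x(j := t))) \<partial>Pi\<^sub>M J M)"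
  using \<open>finite J\<close> \<open>g \<in> _\<close>
proof (induction J arbitrary: g)
  case empty
  then show ?case by (simp add: sq_gap_def PiM_empty nn_integral_count_space_finite)
next
  case (insert i I)
  note [measurable] = insert.prems
  interpret I: prob_space "Pi\<^sub>M I M" by (intro prob_space_PiM P)
  interpret i: prob_space "M i" by (rule P)
  interpret Ii: pair_sigma_finite "Pi\<^sub>M I M" "M i" ..
  have fub: "(\<integral>\<^sup>+y. \<integral>\<^sup>+x. F (x(i := y)) \<partial>Pi\<^sub>M I M \<partial>M i) = integral\<^sup>N (Pi\<^sub>M (insert i I) M) F"
    if "F \<in> borel_measurable (Pi\<^sub>M (insert i I) M)" for F
    using product_nn_integral_insert_rev[OF insert(1,2) that] by simp
  have old: "(\<integral>\<^sup>+y. sq_gap (Pi\<^sub>M I M) (\<lambda>x. g (x(i := y))) \<partial>M i)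
      \<le> (\<Sum>j\<in>I. \<integral>\<^sup>+x. sq_gap (M j) (\<lambda>t. g (x(j := t))) \<partial>Pi\<^sub>M (insert i I) M)"
  proof -
    have twist: "x(j := t, i := y) = x(i := y, j := t)" if "j \<in> I" for x :: "'i \<Rightarrow> 'a" and j t y
      using that insert(2) by auto
    have "(\<integral>\<^sup>+y. sq_gap (Pi\<^sub>M I M) (\<lambda>x. g (x(i := y))) \<partial>M i)
        \<le> (\<integral>\<^sup>+y. (\<Sum>j\<in>I. \<integral>\<^sup>+x. sq_gap (M j) (\<lambda>t. g ((x(j := t))(i := y))) \<partial>Pi\<^sub>M I M) \<partial>M i)"
      by (intro nn_integral_mono insert.IH) measurable
    also have "\<dots> = (\<integral>\<^sup>+y. (\<Sum>j\<in>I. \<integral>\<^sup>+x. sq_gap (M j) (\<lambda>t. g ((x(i := y))(j := t))) \<partial>Pi\<^sub>M I M) \<partial>M i)"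
      by (simp add: twist cong: sum.cong)
    also have "\<dots> = (\<Sum>j\<in>I. \<integral>\<^sup>+y. \<integral>\<^sup>+x. sq_gap (M j) (\<lambda>t. g ((x(i := y))(j := t))) \<partial>Pi\<^sub>M I M \<partial>M i)"
      proof (intro nn_integral_sum)
      fix j assume "j \<in> I"
      then have [measurable]: "(\<lambda>x. sq_gap (M j) (\<lambda>t. g (x(j := t)))) \<in> borel_measurable (Pi\<^sub>M (insert i I) M)"
        by (intro measurable_sq_gap_upd) auto
      show "(\<lambda>y. \<integral>\<^sup>+x. sq_gap (M j) (\<lambda>t. g ((x(i := y))(j := t))) \<partial>Pi\<^sub>M I M) \<in> borel_measurable (M i)"
        by measurable
    qed
    also have "\<dots> = (\<Sum>j\<in>I. \<integral>\<^sup>+x. sq_gap (M j) (\<lambda>t. g (x(j := t))) \<partial>Pi\<^sub>M (insert i I) M)"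
      by (intro sum.cong refl fub measurable_sq_gap_upd) auto
    finally show ?thesis .
  qed
  have new: "(\<integral>\<^sup>+x. sq_gap (M i) (\<lambda>y. g (x(i := y))) \<partial>Pi\<^sub>M I M)
      = (\<integral>\<^sup>+x. sq_gap (M i) (\<lambda>y. g (x(i := y))) \<partial>Pi\<^sub>M (insert i I) M)"
    by (simp add: product_nn_integral_insert[OF insert(1,2) measurable_sq_gap_upd[OF insertI1 insert.prems]]
        i.emeasure_space_1) (simp add: fun_upd_def)
  \<comment> \<open>Bring the two copies of each factor together, as the two-factor inequality wants them.\<close>
  have "sq_gap (Pi\<^sub>M (insert i I) M) g
      = (\<integral>\<^sup>+x. \<integral>\<^sup>+y. \<integral>\<^sup>+x'. \<integral>\<^sup>+y'. ennreal ((g (x(i := y)) - g (x'(i := y')))\<^sup>2)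
          \<partial>M i \<partial>Pi\<^sub>M I M \<partial>M i \<partial>Pi\<^sub>M I M)"
    unfolding sq_gap_def
    by (simp add: product_nn_integral_insert[OF insert(1,2)] cong: nn_integral_cong)
  also have "\<dots> = (\<integral>\<^sup>+x. \<integral>\<^sup>+x'. \<integral>\<^sup>+y. \<integral>\<^sup>+y'. ennreal ((g (x(i := y)) - g (x'(i := y')))\<^sup>2)
          \<partial>M i \<partial>M i \<partial>Pi\<^sub>M I M \<partial>Pi\<^sub>M I M)"
    by (intro nn_integral_cong Ii.Fubini') measurable
  also have "\<dots> \<le> (\<integral>\<^sup>+y. sq_gap (Pi\<^sub>M I M) (\<lambda>x. g (x(i := y))) \<partial>M i)
      + (\<integral>\<^sup>+x. sq_gap (M i) (\<lambda>y. g (x(i := y))) \<partial>Pi\<^sub>M I M)"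
    using sq_gap_two_factors[OF I.prob_space_axioms i.prob_space_axioms,
        of "\<lambda>(x, y). g (x(i := y))"] by simp
  also note add_right_mono[OF old]
  finally show ?case
    unfolding sum.insert[OF insert(1,2)] by (simp only: new add.commute)
qed

lemma sq_gap_eq_variance:
  assumes "prob_space N" and h [measurable]: "h \<in> borel_measurable N"
    and sq: "integrable N (\<lambda>s. (h s)\<^sup>2)"
  shows "sq_gap N h = ennreal (2 * ((\<integral>s. (h s)\<^sup>2 \<partial>N) - (\<integral>s. h s \<partial>N)\<^sup>2))"
proof -
  interpret prob_space N by fact
  have int [simp]: "integrable N h"
    by (rule square_integrable_imp_integrable[OF h sq])
  note [simp] = sq
  let ?m = "\<integral>s. h s \<partial>N" and ?v = "\<integral>s. (h s)\<^sup>2 \<partial>N"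
  have exp: "(h s - h t)\<^sup>2 = (h s)\<^sup>2 - 2 * h s * h t + (h t)\<^sup>2" for s t
    by (simp add: power2_eq_square algebra_simps)
  have "(\<integral>\<^sup>+t. ennreal ((h s - h t)\<^sup>2) \<partial>N) = ennreal ((h s)\<^sup>2 - 2 * h s * ?m + ?v)" for s
    by (subst nn_integral_eq_integral) (simp add: exp, simp, simp add: exp prob_space)
  then have inner: "sq_gap N h = (\<integral>\<^sup>+s. ennreal ((h s)\<^sup>2 - 2 * h s * ?m + ?v) \<partial>N)"
    by (simp add: sq_gap_def)
  have nonneg: "0 \<le> (h s)\<^sup>2 - 2 * h s * ?m + ?v" for s
  proof -
    have "0 \<le> (\<integral>t. (h s - h t)\<^sup>2 \<partial>N)" by simp
    then show ?thesis by (simp add: exp prob_space)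
  qed
  show ?thesis
    unfolding inner
    by (subst nn_integral_eq_integral)
      (simp, simp add: nonneg, simp add: prob_space power2_eq_square[of "expectation h"] mult.assoc)
qed

section \<open>A weighted Poincare inequality on the line\<close>

text \<open>
  For two independent draws from \<open>N\<close>, both in \<open>B\<close>, the events that the second is at most the first
  and that it exceeds the first have the same mass by exchangeability, because ties have mass zero;
  together they have mass \<open>N B\<close> squared.  This does the work of passing to the uniform variable
  \<open>F X\<close>.
\<close>

lemma atomless_order_statistics:
  fixes N :: "real measure"
  assumes "finite_measure N" and sets [measurable_cong]: "sets N = sets borel"
    and atomless: "\<And>s. emeasure N {s} = 0" and B [measurable]: "B \<in> sets borel"
  shows order_statistics_lower: "2 * (\<integral>\<^sup>+s\<in>B. emeasure N (B \<inter> {..s}) \<partial>N) = (emeasure N B)\<^sup>2"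
    and order_statistics_upper: "2 * (\<integral>\<^sup>+s\<in>B. emeasure N (B \<inter> {s<..}) \<partial>N) = (emeasure N B)\<^sup>2"
proof -
  interpret finite_measure N by fact
  interpret NN: pair_sigma_finite N N ..
  let ?low = "\<integral>\<^sup>+s. \<integral>\<^sup>+t. indicator B s * indicator B t * indicator {..s} t \<partial>N \<partial>N"
  let ?up = "\<integral>\<^sup>+s. \<integral>\<^sup>+t. indicator B s * indicator B t * indicator {s<..} t \<partial>N \<partial>N"
  have low: "(\<integral>\<^sup>+s\<in>B. emeasure N (B \<inter> {..s}) \<partial>N) = ?low"
  proof (intro nn_integral_cong)
    fix s
    have "emeasure N (B \<inter> {..s}) = (\<integral>\<^sup>+t. indicator B t * indicator {..s} t \<partial>N)"
      by (simp add: indicator_inter_arith[symmetric])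
    then show "emeasure N (B \<inter> {..s}) * indicator B s
        = (\<integral>\<^sup>+t. indicator B s * indicator B t * indicator {..s} t \<partial>N)"
      by (simp add: nn_integral_cmult mult.assoc) (simp add: mult.commute)
  qed
  have up: "(\<integral>\<^sup>+s\<in>B. emeasure N (B \<inter> {s<..}) \<partial>N) = ?up"
  proof (intro nn_integral_cong)
    fix s
    have "emeasure N (B \<inter> {s<..}) = (\<integral>\<^sup>+t. indicator B t * indicator {s<..} t \<partial>N)"
      by (simp add: indicator_inter_arith[symmetric])
    then show "emeasure N (B \<inter> {s<..}) * indicator B s
        = (\<integral>\<^sup>+t. indicator B s * indicator B t * indicator {s<..} t \<partial>N)"
      by (simp add: nn_integral_cmult mult.assoc) (simp add: mult.commute)
  qed
  have not_atom: "AE t in N. t \<noteq> s" for s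
    using atomless[of s] by (intro AE_I[where N="{s}"]) (auto simp: sets)
  have "?low = (\<integral>\<^sup>+s. \<integral>\<^sup>+t. indicator B s * indicator B t * (if t \<le> s then 1 else 0) \<partial>N \<partial>N)"
    by (intro nn_integral_cong) (auto simp: indicator_def)
  also have "\<dots> = (\<integral>\<^sup>+t. \<integral>\<^sup>+s. indicator B s * indicator B t * (if t \<le> s then 1 else 0) \<partial>N \<partial>N)"
    by (rule NN.Fubini'[symmetric]) measurable
  also have "\<dots> = ?up"
  proof -
    have "(\<integral>\<^sup>+t. indicator B t * indicator B s * (if s \<le> t then 1 else 0) \<partial>N)
        = (\<integral>\<^sup>+t. indicator B s * indicator B t * indicator {s<..} t \<partial>N)" for s
      using not_atom[of s] by (intro nn_integral_cong_AE) (auto simp: indicator_def elim!: eventually_mono)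
    then show ?thesis by simp
  qed
  finally have eq: "?low = ?up" .
  have "?low + ?up = (\<integral>\<^sup>+s. (\<integral>\<^sup>+t. indicator B s * indicator B t * (if t \<le> s then 1 else 0) \<partial>N)
      + (\<integral>\<^sup>+t. indicator B s * indicator B t * (if t \<le> s then 0 else 1) \<partial>N) \<partial>N)"
    by (subst nn_integral_add)
      (auto intro!: arg_cong2[where f="(+)"] nn_integral_cong simp: indicator_def)
  also have "\<dots> = (\<integral>\<^sup>+s. \<integral>\<^sup>+t. indicator B s * indicator B t \<partial>N \<partial>N)"
    by (subst nn_integral_add[symmetric]) (auto intro!: nn_integral_cong simp: indicator_def)
  also have "\<dots> = (emeasure N B)\<^sup>2"
    by (simp add: nn_integral_cmult nn_integral_multc power2_eq_square)
  finally have sum: "?low + ?up = (emeasure N B)\<^sup>2" .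
  show "2 * (\<integral>\<^sup>+s\<in>B. emeasure N (B \<inter> {..s}) \<partial>N) = (emeasure N B)\<^sup>2"
    using sum eq by (simp only: low mult_2)
  show "2 * (\<integral>\<^sup>+s\<in>B. emeasure N (B \<inter> {s<..}) \<partial>N) = (emeasure N B)\<^sup>2"
    using sum eq by (simp only: up mult_2)
qed

lemma (in real_distribution) emeasure_Ioc_cdf:
  "s \<le> t \<Longrightarrow> emeasure M {s<..t} = ennreal (cdf M t - cdf M s)"
  by (cases "s = t") (simp_all add: emeasure_eq_measure cdf_diff_eq)

text \<open>
  The weight \<open>F (1 - F)\<close> of the Poincare inequality arises here: it is twice the expected mass between
  a point below \<open>z\<close> and an independent point above \<open>z\<close>.  Cutting the mass at \<open>z\<close> yields
  \<open>F\<^sup>2 (1 - F) / 2\<close> from the left part and \<open>F (1 - F)\<^sup>2 / 2\<close> from the right part.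
\<close>

lemma (in real_distribution) two_sided_kernel:
  assumes atomless: "\<And>s. emeasure M {s} = 0"
  shows "2 * (\<integral>\<^sup>+s. \<integral>\<^sup>+t. ennreal (cdf M t - cdf M s) * (indicator {..z} s * indicator {z<..} t) \<partial>M \<partial>M)
    = ennreal (cdf M z * (1 - cdf M z))"
proof -
  let ?F = "cdf M"
  have F01: "0 \<le> ?F t" "?F t \<le> 1" for t
    by (simp_all add: cdf_nonneg cdf_bounded_prob)
  have mono: "?F s \<le> ?F t" if "s \<le> t" for s t
    using that by (rule cdf_nondecreasing)
  have [measurable]: "?F \<in> borel_measurable borel"
    by (intro borel_measurable_mono monoI mono)
  have below: "emeasure M {..z} = ennreal (?F z)"
    by (simp add: emeasure_eq_measure cdf_def)
  have "measure M {z<..} = measure M (space M - {..z})"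
    by (rule arg_cong[where f="measure M"]) auto
  also have "\<dots> = 1 - ?F z"
    by (subst prob_compl) (auto simp: cdf_def)
  finally have above: "emeasure M {z<..} = ennreal (1 - ?F z)"
    by (simp add: emeasure_eq_measure)
  have "(\<integral>\<^sup>+s\<in>{..z}. emeasure M ({..z} \<inter> {s<..}) \<partial>M) = (\<integral>\<^sup>+s\<in>{..z}. ennreal (?F z - ?F s) \<partial>M)"
  proof (intro nn_integral_cong)
    fix s
    show "emeasure M ({..z} \<inter> {s<..}) * indicator {..z} s = ennreal (?F z - ?F s) * indicator {..z} s"
    proof (cases "s \<le> z")
      case True
      have "{..z} \<inter> {s<..} = {s<..z}" by auto
      with True show ?thesis by (simp add: emeasure_Ioc_cdf)
    qed auto
  qed
  then have left: "2 * (\<integral>\<^sup>+s\<in>{..z}. ennreal (?F z - ?F s) \<partial>M) = ennreal ((?F z)\<^sup>2)"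
    using order_statistics_upper[OF finite_measure_axioms events_eq_borel atomless, of "{..z}"] below
    by (simp add: ennreal_power F01)
  have "(\<integral>\<^sup>+t\<in>{z<..}. emeasure M ({z<..} \<inter> {..t}) \<partial>M) = (\<integral>\<^sup>+t\<in>{z<..}. ennreal (?F t - ?F z) \<partial>M)"
  proof (intro nn_integral_cong)
    fix t
    show "emeasure M ({z<..} \<inter> {..t}) * indicator {z<..} t = ennreal (?F t - ?F z) * indicator {z<..} t"
    proof (cases "z < t")
      case True
      have "{z<..} \<inter> {..t} = {z<..t}" by auto
      with True show ?thesis by (simp add: emeasure_Ioc_cdf)
    qed auto
  qed
  then have right: "2 * (\<integral>\<^sup>+t\<in>{z<..}. ennreal (?F t - ?F z) \<partial>M) = ennreal ((1 - ?F z)\<^sup>2)"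
    using order_statistics_lower[OF finite_measure_axioms events_eq_borel atomless, of "{z<..}"] above
    by (simp add: ennreal_power F01)
  have split: "ennreal (?F t - ?F s) * (indicator {..z} s * indicator {z<..} t)
      = ennreal (?F z - ?F s) * indicator {..z} s * indicator {z<..} t
      + ennreal (?F t - ?F z) * indicator {z<..} t * indicator {..z} s" for s t
  proof (cases "s \<le> z \<and> z < t")
    case True
    then have "ennreal (?F t - ?F s) = ennreal (?F z - ?F s) + ennreal (?F t - ?F z)"
      using mono[of s z] mono[of z t] by (subst ennreal_plus[symmetric]) auto
    with True show ?thesis by simp
  qed (auto simp: indicator_def)
  have "(\<integral>\<^sup>+s. \<integral>\<^sup>+t. ennreal (?F t - ?F s) * (indicator {..z} s * indicator {z<..} t) \<partial>M \<partial>M)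
      = (\<integral>\<^sup>+s\<in>{..z}. ennreal (?F z - ?F s) \<partial>M) * ennreal (1 - ?F z)
      + (\<integral>\<^sup>+t\<in>{z<..}. ennreal (?F t - ?F z) \<partial>M) * ennreal (?F z)"
    unfolding split
    by (simp add: nn_integral_add nn_integral_cmult nn_integral_multc above below)
  then have "2 * (\<integral>\<^sup>+s. \<integral>\<^sup>+t. ennreal (?F t - ?F s) * (indicator {..z} s * indicator {z<..} t) \<partial>M \<partial>M)
      = ennreal ((?F z)\<^sup>2) * ennreal (1 - ?F z) + ennreal ((1 - ?F z)\<^sup>2) * ennreal (?F z)"
    by (simp add: distrib_left left[symmetric] right[symmetric] mult.assoc)
  also have "\<dots> = ennreal ((?F z)\<^sup>2 * (1 - ?F z) + (1 - ?F z)\<^sup>2 * ?F z)"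
    using F01[of z] by (simp add: ennreal_mult[symmetric] ennreal_plus[symmetric] del: ennreal_plus)
  also have "(?F z)\<^sup>2 * (1 - ?F z) + (1 - ?F z)\<^sup>2 * ?F z = ?F z * (1 - ?F z)"
    by (simp add: power2_eq_square algebra_simps)
  finally show ?thesis .
qed


text \<open>
  The increment is the integral of \<open>(h' / sqrt r) * sqrt r\<close>, to which Cauchy--Schwarz applies.  If
  \<open>h'\<close> is not absolutely integrable on the interval then the Cauchy--Schwarz bound is infinite, so
  the fundamental theorem of calculus has to be used only when \<open>h'\<close> is Lebesgue integrable.  The
  half-open intervals are those for which the kernel \<open>two_sided_kernel\<close> factorises.
\<close>

lemma increment_squared_le:
  fixes r h h' :: "real \<Rightarrow> real"
  assumes [measurable]: "r \<in> borel_measurable borel" "h' \<in> borel_measurable borel"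
    and deriv: "\<And>t. (h has_real_derivative h' t) (at t)"
    and st: "s \<le> t" and pos: "\<And>z. z \<in> {s..t} \<Longrightarrow> 0 < r z"
  shows "ennreal ((h s - h t)\<^sup>2)
    \<le> emeasure (marginal r) {s<..t} * (\<integral>\<^sup>+z. ennreal ((h' z)\<^sup>2 / r z) * indicator {s..<t} z \<partial>lborel)"
proof -
  let ?L = "\<integral>\<^sup>+z. ennreal (\<bar>h' z\<bar> * indicator {s..t} z) \<partial>lborel"
  have "ennreal \<bar>h t - h s\<bar> \<le> ?L"
  proof (cases "?L = \<infinity>")
    case False
    then have int: "integrable lborel (\<lambda>z. indicator {s..t} z *\<^sub>R h' z)"
      by (intro integrableI_bounded) (auto simp: abs_mult less_top mult.commute)
    have "(h' has_integral (h t - h s)) {s..t}"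
      using st deriv
      by (intro fundamental_theorem_of_calculus)
        (auto simp: has_real_derivative_iff_has_vector_derivative[symmetric]
          intro: has_field_derivative_at_within)
    then have "h t - h s = (LINT z:{s..t}|lborel. h' z)"
      using set_borel_integral_eq_integral(2)[of "{s..t}" h'] int
      by (simp add: set_integrable_def integral_unique)
    then show ?thesis
      using integral_norm_bound_ennreal[OF int]
      by (simp add: set_lebesgue_integral_def abs_mult mult.commute)
  qed simp
  also have "?L = (\<integral>\<^sup>+z. ennreal (\<bar>h' z\<bar> / sqrt (r z) * indicator {s..t} z)
      * ennreal (sqrt (r z) * indicator {s..t} z) \<partial>lborel)"
  proof (intro nn_integral_cong)
    fix z
    show "ennreal (\<bar>h' z\<bar> * indicator {s..t} z) = ennreal (\<bar>h' z\<bar> / sqrt (r z) * indicator {s..t} z)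
        * ennreal (sqrt (r z) * indicator {s..t} z)"
      using pos[of z] by (cases "z \<in> {s..t}") (simp_all add: ennreal_mult'[symmetric])
  qed
  finally have "(ennreal \<bar>h t - h s\<bar>)\<^sup>2 \<le> (\<integral>\<^sup>+z. ennreal (\<bar>h' z\<bar> / sqrt (r z) * indicator {s..t} z)
      * ennreal (sqrt (r z) * indicator {s..t} z) \<partial>lborel)\<^sup>2"
    by (intro power_mono) auto
  also have "\<dots> \<le> (\<integral>\<^sup>+z. (ennreal (\<bar>h' z\<bar> / sqrt (r z) * indicator {s..t} z))\<^sup>2 \<partial>lborel)
      * (\<integral>\<^sup>+z. (ennreal (sqrt (r z) * indicator {s..t} z))\<^sup>2 \<partial>lborel)"
    by (rule Cauchy_Schwarz_nn_integral) measurable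
  also have "(\<integral>\<^sup>+z. (ennreal (\<bar>h' z\<bar> / sqrt (r z) * indicator {s..t} z))\<^sup>2 \<partial>lborel)
      = (\<integral>\<^sup>+z. ennreal ((h' z)\<^sup>2 / r z) * indicator {s..<t} z \<partial>lborel)"
  proof (rule nn_integral_cong_AE)
    show "AE z in lborel. (ennreal (\<bar>h' z\<bar> / sqrt (r z) * indicator {s..t} z))\<^sup>2
        = ennreal ((h' z)\<^sup>2 / r z) * indicator {s..<t} z"
      using AE_lborel_singleton[of t]
    proof eventually_elim
      case (elim z)
      show ?case
      proof (cases "z \<in> {s..t}")
        case True
        then have "0 < r z" by (rule pos)
        with True elim show ?thesis by (simp add: ennreal_power power_divide)
      qed auto
    qed
  qed
  also have "(\<integral>\<^sup>+z. (ennreal (sqrt (r z) * indicator {s..t} z))\<^sup>2 \<partial>lborel) = emeasure (marginal r) {s<..t}"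
  proof -
    have "AE z in lborel. (ennreal (sqrt (r z) * indicator {s..t} z))\<^sup>2 = ennreal (r z) * indicator {s<..t} z"
      using AE_lborel_singleton[of s]
    proof eventually_elim
      case (elim z)
      show ?case
      proof (cases "z \<in> {s..t}")
        case True
        then have "0 < r z" by (rule pos)
        with True elim show ?thesis by (simp add: ennreal_power)
      qed auto
    qed
    then show ?thesis
      unfolding marginal_def by (subst emeasure_density) (auto intro!: nn_integral_cong_AE)
  qed
  finally show ?thesis
    by (simp add: ennreal_power power2_commute mult.commute)
qed

text \<open>
  The weighted Poincare inequality on the line.  Since \<open>sq_gap\<close> is twice the variance, this says that
  the variance of \<open>h\<close> is at most half the weighted energy, and \<open>1/2\<close> is the best constant: for the
  uniform law on \<open>[0, 1]\<close> it is the reciprocal of the first nonzero eigenvalue \<open>2\<close> of the Legendre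
  operator, attained by affine functions.  The proof bounds each squared increment by
  \<open>increment_squared_le\<close>, integrates over the two endpoints, and exchanges the integrals so that the
  endpoints are integrated first, for a fixed point \<open>z\<close> between them.
\<close>

lemma weighted_poincare:
  fixes r h h' :: "real \<Rightarrow> real"
  assumes "prob_space (marginal r)"
    and [measurable]: "r \<in> borel_measurable borel" "h' \<in> borel_measurable borel"
    and deriv: "\<And>t. (h has_real_derivative h' t) (at t)"
    and I: "is_interval I" "\<And>t. t \<in> I \<Longrightarrow> 0 < r t" "\<And>t. t \<notin> I \<Longrightarrow> r t = 0"
  shows "sq_gap (marginal r) h \<le> (\<integral>\<^sup>+t. ennreal (weight r t * (h' t)\<^sup>2) \<partial>marginal r)"
proof -
  let ?N = "marginal r" and ?F = "cdf (marginal r)"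
  interpret N: prob_space ?N by fact
  have sets [measurable_cong]: "sets ?N = sets borel" and space: "space ?N = UNIV"
    by (simp_all add: marginal_def)
  interpret N: real_distribution ?N
    by standard (simp_all add: sets space)
  interpret NN: pair_sigma_finite ?N ?N ..
  interpret LN: pair_sigma_finite lborel ?N ..
  have [measurable]: "?F \<in> borel_measurable borel"
    by (intro borel_measurable_mono monoI N.cdf_nondecreasing)
  have [measurable]: "h \<in> borel_measurable borel"
    using deriv by (intro borel_measurable_continuous_onI) (meson DERIV_isCont continuous_at_imp_continuous_on)
  have atomless: "emeasure ?N {s} = 0" for s
    unfolding marginal_def by (subst emeasure_density) (auto simp: nn_integral_indicator_singleton)
  have support: "AE t in ?N. t \<in> I"
  proof -
    have "t \<in> I" if "0 < ennreal (r t)" for t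
      using that I(3)[of t] by (cases "t \<in> I") auto
    then show ?thesis
      unfolding marginal_def by (subst AE_density) auto
  qed

  define \<phi> where "\<phi> z = ennreal ((h' z)\<^sup>2 / r z)" for z
  have [measurable]: "\<phi> \<in> borel_measurable borel" unfolding \<phi>_def by measurable
  define c where "c s t = (if s < t then 1 else 0 :: ennreal)" for s t :: real
  have [measurable]: "(\<lambda>(s, t). c s t) \<in> borel_measurable (borel \<Otimes>\<^sub>M borel)"
    unfolding c_def by measurable
  let ?half = "\<integral>\<^sup>+s. \<integral>\<^sup>+t. ennreal ((h s - h t)\<^sup>2) * c s t \<partial>?N \<partial>?N"

  have kernel: "\<phi> z * (ennreal (?F t - ?F s) * (indicator {..z} s * indicator {z<..} t))
      = (if s \<le> z \<and> z < t then \<phi> z * ennreal (?F t - ?F s) else 0)" for s t z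
    by (auto simp: indicator_def)

  \<comment> \<open>By symmetry only the pairs with \<open>s < t\<close> need to be considered.\<close>
  have split_order: "(\<integral>\<^sup>+t. ennreal ((h s - h t)\<^sup>2) \<partial>?N)
      = (\<integral>\<^sup>+t. ennreal ((h s - h t)\<^sup>2) * c s t \<partial>?N) + (\<integral>\<^sup>+t. ennreal ((h s - h t)\<^sup>2) * c t s \<partial>?N)"
    for s
  proof -
    have "(\<integral>\<^sup>+t. ennreal ((h s - h t)\<^sup>2) \<partial>?N)
        = (\<integral>\<^sup>+t. ennreal ((h s - h t)\<^sup>2) * c s t + ennreal ((h s - h t)\<^sup>2) * c t s \<partial>?N)"
      by (intro nn_integral_cong) (auto simp: c_def not_less_iff_gr_or_eq)
    also have "\<dots> = (\<integral>\<^sup>+t. ennreal ((h s - h t)\<^sup>2) * c s t \<partial>?N)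
        + (\<integral>\<^sup>+t. ennreal ((h s - h t)\<^sup>2) * c t s \<partial>?N)"
      by (rule nn_integral_add) measurable
    finally show ?thesis .
  qed
  have swap: "(\<integral>\<^sup>+s. \<integral>\<^sup>+t. ennreal ((h s - h t)\<^sup>2) * c t s \<partial>?N \<partial>?N) = ?half"
  proof -
    have "(\<integral>\<^sup>+s. \<integral>\<^sup>+t. ennreal ((h s - h t)\<^sup>2) * c t s \<partial>?N \<partial>?N)
        = (\<integral>\<^sup>+s. \<integral>\<^sup>+t. ennreal ((h t - h s)\<^sup>2) * c t s \<partial>?N \<partial>?N)"
      by (intro nn_integral_cong) (subst power2_commute, rule refl)
    also have "\<dots> = ?half"
      by (rule NN.Fubini'[of "\<lambda>s t. ennreal ((h s - h t)\<^sup>2) * c s t"]) measurable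
    finally show ?thesis .
  qed
  have "sq_gap ?N h = (\<integral>\<^sup>+s. (\<integral>\<^sup>+t. ennreal ((h s - h t)\<^sup>2) * c s t \<partial>?N)
      + (\<integral>\<^sup>+t. ennreal ((h s - h t)\<^sup>2) * c t s \<partial>?N) \<partial>?N)"
    unfolding sq_gap_def by (intro nn_integral_cong split_order)
  also have "\<dots> = ?half + (\<integral>\<^sup>+s. \<integral>\<^sup>+t. ennreal ((h s - h t)\<^sup>2) * c t s \<partial>?N \<partial>?N)"
    by (rule nn_integral_add) measurable
  finally have doubled: "sq_gap ?N h = 2 * ?half"
    by (simp only: swap mult_2)

  \<comment> \<open>The indicators say that \<open>z\<close> lies in \<open>{s..<t}\<close>; for \<open>t \<le> s\<close> both sides vanish.\<close>
  have "?half \<le> (\<integral>\<^sup>+s. \<integral>\<^sup>+t. \<integral>\<^sup>+z. \<phi> z * (ennreal (?F t - ?F s)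
      * (indicator {..z} s * indicator {z<..} t)) \<partial>lborel \<partial>?N \<partial>?N)"
  proof (rule nn_integral_mono_AE)
    show "AE s in ?N. (\<integral>\<^sup>+t. ennreal ((h s - h t)\<^sup>2) * c s t \<partial>?N) \<le> (\<integral>\<^sup>+t. \<integral>\<^sup>+z. \<phi> z * (ennreal (?F t - ?F s)
      * (indicator {..z} s * indicator {z<..} t)) \<partial>lborel \<partial>?N)"
      using support
    proof eventually_elim
      case (elim s)
      show ?case
      proof (rule nn_integral_mono_AE)
        show "AE t in ?N. ennreal ((h s - h t)\<^sup>2) * c s t \<le> (\<integral>\<^sup>+z. \<phi> z * (ennreal (?F t - ?F s)
            * (indicator {..z} s * indicator {z<..} t)) \<partial>lborel)"
          using support
        proof eventually_elim
          case (elim t)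
          show ?case
          proof (cases "s < t")
            case True
            have "{s..t} \<subseteq> I"
              using I(1) \<open>s \<in> I\<close> \<open>t \<in> I\<close> unfolding is_interval_1
              by (meson atLeastAtMost_iff subsetI)
            then have pos: "0 < r z" if "z \<in> {s..t}" for z
              using that by (intro I(2)) blast
            have "ennreal ((h s - h t)\<^sup>2)
                \<le> emeasure ?N {s<..t} * (\<integral>\<^sup>+z. \<phi> z * indicator {s..<t} z \<partial>lborel)"
              unfolding \<phi>_def
              by (rule increment_squared_le[OF assms(2,3) deriv less_imp_le[OF True] pos])
            also have "\<dots> = (\<integral>\<^sup>+z. ennreal (?F t - ?F s) * (\<phi> z * indicator {s..<t} z) \<partial>lborel)"
              using True N.emeasure_Ioc_cdf[of s t] by (subst nn_integral_cmult) auto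
            also have "\<dots> = (\<integral>\<^sup>+z. \<phi> z * (ennreal (?F t - ?F s)
                * (indicator {..z} s * indicator {z<..} t)) \<partial>lborel)"
              by (intro nn_integral_cong) (auto simp: indicator_def ac_simps)
            finally show ?thesis using True by (simp add: c_def)
          qed (simp add: c_def)
        qed
      qed
    qed
  qed
  also have "\<dots> = (\<integral>\<^sup>+s. \<integral>\<^sup>+z. \<integral>\<^sup>+t. \<phi> z * (ennreal (?F t - ?F s)
      * (indicator {..z} s * indicator {z<..} t)) \<partial>?N \<partial>lborel \<partial>?N)"
    unfolding kernel by (intro nn_integral_cong LN.Fubini') measurable
  also have "\<dots> = (\<integral>\<^sup>+z. \<integral>\<^sup>+s. \<integral>\<^sup>+t. \<phi> z * (ennreal (?F t - ?F s)
      * (indicator {..z} s * indicator {z<..} t)) \<partial>?N \<partial>?N \<partial>lborel)"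
    unfolding kernel by (intro LN.Fubini') measurable
  also have "\<dots> = (\<integral>\<^sup>+z. \<phi> z * (\<integral>\<^sup>+s. \<integral>\<^sup>+t. ennreal (?F t - ?F s)
      * (indicator {..z} s * indicator {z<..} t) \<partial>?N \<partial>?N) \<partial>lborel)"
    by (simp add: nn_integral_cmult)
  finally have half_le: "?half \<le> (\<integral>\<^sup>+z. \<phi> z * (\<integral>\<^sup>+s. \<integral>\<^sup>+t. ennreal (?F t - ?F s)
      * (indicator {..z} s * indicator {z<..} t) \<partial>?N \<partial>?N) \<partial>lborel)" (is "_ \<le> ?T") .
  have "2 * ?T = (\<integral>\<^sup>+z. \<phi> z * ennreal (?F z * (1 - ?F z)) \<partial>lborel)"
  proof -
    let ?K = "\<lambda>z. \<integral>\<^sup>+s. \<integral>\<^sup>+t. ennreal (?F t - ?F s)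
      * (indicator {..z} s * indicator {z<..} t) \<partial>?N \<partial>?N"
    have if_form: "ennreal (?F t - ?F s) * (indicator {..z} s * indicator {z<..} t)
        = (if s \<le> z \<and> z < t then ennreal (?F t - ?F s) else 0)" for s t z
      by (auto simp: indicator_def)
    have [measurable]: "?K \<in> borel_measurable lborel"
      unfolding if_form by measurable
    have "2 * ?T = (\<integral>\<^sup>+z. 2 * (\<phi> z * ?K z) \<partial>lborel)"
      by (rule nn_integral_cmult[symmetric]) measurable
    also have "\<dots> = (\<integral>\<^sup>+z. \<phi> z * (2 * ?K z) \<partial>lborel)"
      by (simp only: mult.left_commute)
    finally show ?thesis
      by (simp only: N.two_sided_kernel[OF atomless])
  qed
  also have "\<dots> = (\<integral>\<^sup>+t. ennreal (weight r t * (h' t)\<^sup>2) \<partial>?N)"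
    unfolding marginal_def
  proof (subst nn_integral_density)
    show "(\<integral>\<^sup>+z. \<phi> z * ennreal (cdf (density lborel (\<lambda>t. ennreal (r t))) z
          * (1 - cdf (density lborel (\<lambda>t. ennreal (r t))) z)) \<partial>lborel)
        = (\<integral>\<^sup>+t. ennreal (r t) * ennreal (weight r t * (h' t)\<^sup>2) \<partial>lborel)"
      unfolding marginal_def[symmetric]
    proof (intro nn_integral_cong)
      fix z
      show "\<phi> z * ennreal (?F z * (1 - ?F z)) = ennreal (r z) * ennreal (weight r z * (h' z)\<^sup>2)"
      proof (cases "z \<in> I")
        case True
        then have "0 < r z" by (rule I)
        then have "(h' z)\<^sup>2 / r z * (?F z * (1 - ?F z)) = r z * (weight r z * (h' z)\<^sup>2)"
          by (simp add: weight_def power2_eq_square)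
        then show ?thesis
          using \<open>0 < r z\<close> by (simp add: \<phi>_def ennreal_mult'[symmetric])
      qed (simp add: \<phi>_def I)
    qed
  qed (auto simp: weight_def)
  finally show ?thesis
    using mult_left_mono[OF half_le, of 2] by (simp only: doubled zero_le)
qed

section \<open>One coordinate of a random vector\<close>

lemma weight_nonneg: "prob_space (marginal r) \<Longrightarrow> 0 \<le> weight r t"
  by (simp add: weight_def cdf_def prob_space.prob_le_1)

lemma measurable_vecI:
  fixes f :: "'a \<Rightarrow> real ^ 'd"
  assumes "\<And>i. (\<lambda>x. f x $ i) \<in> borel_measurable M"
  shows "f \<in> borel_measurable M"
  using assms
  by (subst borel_measurable_euclidean_space) (auto simp: Basis_vec_def inner_axis)

declare borel_measurable_nth [measurable]

lemma measurable_upd_coord [measurable]: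
  "(\<lambda>(x, t). upd_coord x j t) \<in> borel \<Otimes>\<^sub>M borel \<rightarrow>\<^sub>M (borel :: (real ^ 'd) measure)"
proof (rule measurable_vecI)
  fix i
  show "(\<lambda>p. (case p of (x, t) \<Rightarrow> upd_coord x j t) $ i) \<in> borel_measurable (borel \<Otimes>\<^sub>M (borel :: real measure))"
    unfolding upd_coord_def by (cases "i = j") (simp_all add: case_prod_beta', measurable)
qed

lemma measurable_vec_of_fun: "(\<lambda>y. \<chi> j. y j) \<in> (\<Pi>\<^sub>M j\<in>UNIV. marginal (\<rho> j)) \<rightarrow>\<^sub>M (borel :: (real ^ 'd) measure)"
  by (rule measurable_vecI) (simp add: marginal_def)

lemma vec_of_fun_upd: "(\<chi> i. (y(j := t)) i) = upd_coord (\<chi> i. y i) j t"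
  by (simp add: upd_coord_def vec_eq_iff)

lemma nn_integral_prod_law:
  "F \<in> borel_measurable borel \<Longrightarrow>
    (\<integral>\<^sup>+x. F x \<partial>prod_law \<rho>) = (\<integral>\<^sup>+y. F (\<chi> j. y j) \<partial>(\<Pi>\<^sub>M j\<in>UNIV. marginal (\<rho> j)))"
  unfolding prod_law_def by (rule nn_integral_distr[OF measurable_vec_of_fun]) simp

lemma measurable_sq_gap_coord:
  fixes g :: "real ^ 'd \<Rightarrow> real"
  assumes "prob_space (marginal r)" and [measurable]: "g \<in> borel_measurable borel"
  shows "(\<lambda>x. sq_gap (marginal r) (\<lambda>t. g (upd_coord x j t))) \<in> borel_measurable borel"
proof -
  interpret prob_space "marginal r" by fact
  have [measurable_cong]: "sets (marginal r) = sets borel" by (simp add: marginal_def)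
  show ?thesis unfolding sq_gap_def by measurable
qed

context
  fixes \<rho> :: "'d::finite \<Rightarrow> real \<Rightarrow> real"
  assumes prob: "\<And>j. prob_space (marginal (\<rho> j))"
begin

lemma product_sigma_finite_marginals: "product_sigma_finite (\<lambda>j. marginal (\<rho> j))"
  by (intro product_sigma_finite.intro prob_space_imp_sigma_finite prob)

text \<open>Redrawing one coordinate independently does not change the law of the vector.\<close>

lemma nn_integral_refresh_coord:
  assumes F [measurable]: "F \<in> borel_measurable borel"
  shows "(\<integral>\<^sup>+x. \<integral>\<^sup>+t. F (upd_coord x j t) \<partial>marginal (\<rho> j) \<partial>prod_law \<rho>) = (\<integral>\<^sup>+x. F x \<partial>prod_law \<rho>)"
proof -
  interpret product_sigma_finite "\<lambda>j. marginal (\<rho> j)" by (rule product_sigma_finite_marginals)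
  interpret j: prob_space "marginal (\<rho> j)" by (rule prob)
  let ?\<Pi> = "\<lambda>I. \<Pi>\<^sub>M j\<in>I. marginal (\<rho> j)"
  have [measurable_cong]: "sets (marginal r) = sets borel" for r by (simp add: marginal_def)
  have U: "UNIV = insert j (UNIV - {j})" by auto
  have [measurable]: "(\<lambda>y. F (\<chi> j. y j)) \<in> borel_measurable (?\<Pi> UNIV)"
    by (rule measurable_compose[OF measurable_vec_of_fun F])
  have [measurable]: "(\<lambda>y. \<integral>\<^sup>+t. F (upd_coord (\<chi> j. y j) j t) \<partial>marginal (\<rho> j)) \<in> borel_measurable (?\<Pi> UNIV)"
    by (rule measurable_compose[OF measurable_vec_of_fun]) measurable
  have "(\<integral>\<^sup>+x. \<integral>\<^sup>+t. F (upd_coord x j t) \<partial>marginal (\<rho> j) \<partial>prod_law \<rho>)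
      = (\<integral>\<^sup>+y. \<integral>\<^sup>+t. F (\<chi> i. (y(j := t)) i) \<partial>marginal (\<rho> j) \<partial>?\<Pi> UNIV)"
    by (subst nn_integral_prod_law) (simp_all only: vec_of_fun_upd, measurable)
  also have "\<dots> = (\<integral>\<^sup>+y. \<integral>\<^sup>+s. \<integral>\<^sup>+t. F (\<chi> i. ((y(j := s))(j := t)) i) \<partial>marginal (\<rho> j) \<partial>marginal (\<rho> j) \<partial>?\<Pi> (UNIV - {j}))"
    using product_nn_integral_insert[of "UNIV - {j}" j "\<lambda>y. \<integral>\<^sup>+t. F (\<chi> i. (y(j := t)) i) \<partial>marginal (\<rho> j)"]
    by (simp only: U[symmetric] vec_of_fun_upd) simp
  also have "\<dots> = (\<integral>\<^sup>+y. \<integral>\<^sup>+t. F (\<chi> i. (y(j := t)) i) \<partial>marginal (\<rho> j) \<partial>?\<Pi> (UNIV - {j}))"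
    by (simp add: j.emeasure_space_1)
  also have "\<dots> = (\<integral>\<^sup>+y. F (\<chi> j. y j) \<partial>?\<Pi> UNIV)"
    using product_nn_integral_insert[of "UNIV - {j}" j "\<lambda>y. F (\<chi> j. y j)"]
    by (simp only: U[symmetric]) simp
  also have "\<dots> = (\<integral>\<^sup>+x. F x \<partial>prod_law \<rho>)"
    by (rule nn_integral_prod_law[OF F, symmetric])
  finally show ?thesis .
qed

lemma efron_stein_prod_law:
  fixes g :: "real ^ 'd \<Rightarrow> real"
  assumes g [measurable]: "g \<in> borel_measurable borel"
  shows "sq_gap (prod_law \<rho>) g
    \<le> (\<Sum>j\<in>UNIV. \<integral>\<^sup>+x. sq_gap (marginal (\<rho> j)) (\<lambda>t. g (upd_coord x j t)) \<partial>prod_law \<rho>)"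
proof -
  interpret product_sigma_finite "\<lambda>j. marginal (\<rho> j)" by (rule product_sigma_finite_marginals)
  let ?\<Pi> = "\<Pi>\<^sub>M j\<in>UNIV. marginal (\<rho> j)"
  interpret \<Pi>: prob_space ?\<Pi> by (intro prob_space_PiM prob)
  have sets [measurable_cong]: "sets (prod_law \<rho>) = sets borel" by (simp add: prod_law_def)
  interpret L: prob_space "prod_law \<rho>"
    unfolding prod_law_def by (rule \<Pi>.prob_space_distr[OF measurable_vec_of_fun])
  have gv: "(\<lambda>y. g (\<chi> j. y j)) \<in> borel_measurable ?\<Pi>"
    by (rule measurable_compose[OF measurable_vec_of_fun g])
  have "sq_gap (prod_law \<rho>) g = sq_gap ?\<Pi> (\<lambda>y. g (\<chi> j. y j))"
    unfolding sq_gap_def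
    by (subst nn_integral_prod_law, measurable) (simp add: nn_integral_prod_law)
  also have "\<dots> \<le> (\<Sum>j\<in>UNIV. \<integral>\<^sup>+y. sq_gap (marginal (\<rho> j)) (\<lambda>t. g (\<chi> i. (y(j := t)) i)) \<partial>?\<Pi>)"
    by (rule efron_stein[OF finite prob gv])
  also have "\<dots> = (\<Sum>j\<in>UNIV. \<integral>\<^sup>+x. sq_gap (marginal (\<rho> j)) (\<lambda>t. g (upd_coord x j t)) \<partial>prod_law \<rho>)"
    unfolding vec_of_fun_upd
    by (intro sum.cong refl nn_integral_prod_law[symmetric] measurable_sq_gap_coord prob g)
  finally show ?thesis .
qed

text \<open>
  On each line parallel to the \<open>j\<close>-th axis this is \<open>weighted_poincare\<close>; the integral over the line is
  then absorbed by redrawing the \<open>j\<close>-th coordinate.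
\<close>

lemma sq_gap_coord_le_derivative:
  fixes g :: "real ^ 'd \<Rightarrow> real"
  assumes [measurable]: "\<rho> j \<in> borel_measurable borel" "g' \<in> borel_measurable borel"
    and deriv: "\<And>x. ((\<lambda>t. g (upd_coord x j t)) has_real_derivative g' x) (at (x $ j))"
    and I: "is_interval I" "\<And>t. t \<in> I \<Longrightarrow> 0 < \<rho> j t" "\<And>t. t \<notin> I \<Longrightarrow> \<rho> j t = 0"
  shows "(\<integral>\<^sup>+x. sq_gap (marginal (\<rho> j)) (\<lambda>t. g (upd_coord x j t)) \<partial>prod_law \<rho>)
    \<le> (\<integral>\<^sup>+x. ennreal (weight (\<rho> j) (x $ j) * (g' x)\<^sup>2) \<partial>prod_law \<rho>)"
proof -
  interpret j: prob_space "marginal (\<rho> j)" by (rule prob)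
  interpret j: real_distribution "marginal (\<rho> j)"
    by standard (simp_all add: marginal_def)
  have [measurable]: "cdf (marginal (\<rho> j)) \<in> borel_measurable borel"
    by (intro borel_measurable_mono monoI j.cdf_nondecreasing)
  have [measurable]: "weight (\<rho> j) \<in> borel_measurable borel"
    unfolding weight_def by measurable
  have "(\<integral>\<^sup>+x. sq_gap (marginal (\<rho> j)) (\<lambda>t. g (upd_coord x j t)) \<partial>prod_law \<rho>)
      \<le> (\<integral>\<^sup>+x. \<integral>\<^sup>+t. ennreal (weight (\<rho> j) (upd_coord x j t $ j) * (g' (upd_coord x j t))\<^sup>2)
          \<partial>marginal (\<rho> j) \<partial>prod_law \<rho>)"
  proof (rule nn_integral_mono)
    fix x
    have d: "((\<lambda>s. g (upd_coord x j s)) has_real_derivative g' (upd_coord x j t)) (at t)" for t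
    proof -
      have "upd_coord (upd_coord x j t) j s = upd_coord x j s" for s
        by (simp add: upd_coord_def vec_eq_iff)
      moreover have "upd_coord x j t $ j = t"
        by (simp add: upd_coord_def)
      ultimately show ?thesis using deriv[of "upd_coord x j t"] by simp
    qed
    have "sq_gap (marginal (\<rho> j)) (\<lambda>t. g (upd_coord x j t))
        \<le> (\<integral>\<^sup>+t. ennreal (weight (\<rho> j) t * (g' (upd_coord x j t))\<^sup>2) \<partial>marginal (\<rho> j))"
      by (rule weighted_poincare[OF prob _ _ d I]) measurable
    then show "sq_gap (marginal (\<rho> j)) (\<lambda>t. g (upd_coord x j t))
        \<le> (\<integral>\<^sup>+t. ennreal (weight (\<rho> j) (upd_coord x j t $ j) * (g' (upd_coord x j t))\<^sup>2) \<partial>marginal (\<rho> j))"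
      by (simp add: upd_coord_def)
  qed
  also have "\<dots> = (\<integral>\<^sup>+x. ennreal (weight (\<rho> j) (x $ j) * (g' x)\<^sup>2) \<partial>prod_law \<rho>)"
    by (rule nn_integral_refresh_coord) measurable
  finally show ?thesis .
qed

lemma AE_square_integrable_coord:
  fixes g :: "real ^ 'd \<Rightarrow> 'b::euclidean_space"
  assumes [measurable]: "g \<in> borel_measurable borel"
    and sq: "integrable (prod_law \<rho>) (\<lambda>x. (norm (g x))\<^sup>2)"
  shows "AE x in prod_law \<rho>. integrable (marginal (\<rho> j)) (\<lambda>t. (norm (g (upd_coord x j t)))\<^sup>2)"
proof -
  interpret j: prob_space "marginal (\<rho> j)" by (rule prob)
  have [measurable_cong]: "sets (marginal r) = sets borel" for r by (simp add: marginal_def)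
  have [measurable_cong]: "sets (prod_law \<rho>) = sets borel" by (simp add: prod_law_def)
  have "(\<integral>\<^sup>+x. \<integral>\<^sup>+t. ennreal ((norm (g (upd_coord x j t)))\<^sup>2) \<partial>marginal (\<rho> j) \<partial>prod_law \<rho>)
      = (\<integral>\<^sup>+x. ennreal ((norm (g x))\<^sup>2) \<partial>prod_law \<rho>)"
    by (rule nn_integral_refresh_coord) measurable
  also have "\<dots> \<noteq> \<infinity>"
    using sq by (simp add: nn_integral_eq_integral)
  finally have "AE x in prod_law \<rho>. (\<integral>\<^sup>+t. ennreal ((norm (g (upd_coord x j t)))\<^sup>2) \<partial>marginal (\<rho> j)) \<noteq> \<infinity>"
    by (intro nn_integral_PInf_AE) measurable
  then show ?thesis
    by eventually_elim (intro integrableI_bounded, measurable, simp add: less_top)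
qed

text \<open>
  If \<open>g\<close> is centred on almost every line parallel to the \<open>j\<close>-th axis, then its variance on such a
  line is its second moment there, and the second moments on the lines average to the full one.
\<close>

lemma second_moment_eq_sq_gap_coord:
  fixes g :: "real ^ 'd \<Rightarrow> real"
  assumes [measurable]: "g \<in> borel_measurable borel"
    and sq: "integrable (prod_law \<rho>) (\<lambda>x. (g x)\<^sup>2)"
    and zero: "AE x in prod_law \<rho>. (\<integral>t. g (upd_coord x j t) \<partial>marginal (\<rho> j)) = 0"
  shows "2 * (\<integral>\<^sup>+x. ennreal ((g x)\<^sup>2) \<partial>prod_law \<rho>)
    = (\<integral>\<^sup>+x. sq_gap (marginal (\<rho> j)) (\<lambda>t. g (upd_coord x j t)) \<partial>prod_law \<rho>)"
proof -
  interpret j: prob_space "marginal (\<rho> j)" by (rule prob)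
  have [measurable_cong]: "sets (marginal r) = sets borel" for r by (simp add: marginal_def)
  have [measurable_cong]: "sets (prod_law \<rho>) = sets borel" by (simp add: prod_law_def)
  have refresh: "(\<integral>\<^sup>+x. \<integral>\<^sup>+t. ennreal ((g (upd_coord x j t))\<^sup>2) \<partial>marginal (\<rho> j) \<partial>prod_law \<rho>)
      = (\<integral>\<^sup>+x. ennreal ((g x)\<^sup>2) \<partial>prod_law \<rho>)"
    by (rule nn_integral_refresh_coord) measurable
  have "AE x in prod_law \<rho>. integrable (marginal (\<rho> j)) (\<lambda>t. (g (upd_coord x j t))\<^sup>2)"
    using AE_square_integrable_coord[of g] sq by simp
  then have "AE x in prod_law \<rho>. 2 * (\<integral>\<^sup>+t. ennreal ((g (upd_coord x j t))\<^sup>2) \<partial>marginal (\<rho> j))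
      = sq_gap (marginal (\<rho> j)) (\<lambda>t. g (upd_coord x j t))"
    using zero
  proof eventually_elim
    case (elim x)
    have m [measurable]: "(\<lambda>t. g (upd_coord x j t)) \<in> borel_measurable (marginal (\<rho> j))"
      by measurable
    show ?case
      using elim
      by (simp add: sq_gap_eq_variance[OF prob m] nn_integral_eq_integral ennreal_mult)
  qed
  then have "(\<integral>\<^sup>+x. sq_gap (marginal (\<rho> j)) (\<lambda>t. g (upd_coord x j t)) \<partial>prod_law \<rho>)
      = (\<integral>\<^sup>+x. 2 * (\<integral>\<^sup>+t. ennreal ((g (upd_coord x j t))\<^sup>2) \<partial>marginal (\<rho> j)) \<partial>prod_law \<rho>)"
    by (intro nn_integral_cong_AE) (auto elim: eventually_mono)
  also have "\<dots> = 2 * (\<integral>\<^sup>+x. ennreal ((g x)\<^sup>2) \<partial>prod_law \<rho>)"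
    unfolding refresh[symmetric] by (rule nn_integral_cmult) measurable
  finally show ?thesis by simp
qed

end

section \<open>Quadratic forms and matrix integrals\<close>

lemma form_outer: "c \<bullet> (outer a b *v c) = (c \<bullet> a) * (c \<bullet> b)"
proof -
  have "outer a b *v c = (c \<bullet> b) *\<^sub>R a"
    by (simp add: outer_def matrix_vector_mult_def vec_eq_iff inner_vec_def sum_distrib_left
        sum_distrib_right mult_ac)
  then show ?thesis by simp
qed

text \<open>
  Evaluating at a fixed \<open>c\<close> turns a matrix integral into the integral of a real function, so the
  matrix inequalities reduce to scalar ones for \<open>c \<bullet> f\<close>.
\<close>

lemma bounded_linear_form: "bounded_linear (\<lambda>A :: real ^ 'n ^ 'n. c \<bullet> (A *v c))"
  by (intro linear_conv_bounded_linear[THEN iffD1] linearI)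
    (simp_all add: matrix_vector_mult_add_rdistrib inner_add_right scaleR_matrix_vector_assoc[symmetric])

lemma linear_transpose: "linear (transpose :: real ^ 'n ^ 'n \<Rightarrow> real ^ 'n ^ 'n)"
  by (rule linearI) (simp_all add: transpose_def vec_eq_iff)

lemmas bounded_linear_transpose = linear_conv_bounded_linear[THEN iffD1, OF linear_transpose]

lemma transpose_outer_self: "transpose (outer a a) = outer a a"
  by (simp add: transpose_def outer_def mult.commute)

lemma norm_outer: "norm (outer a b) = norm a * norm b"
proof -
  have "outer a b \<bullet> outer a b = (a \<bullet> a) * (b \<bullet> b)"
    by (simp add: outer_def inner_vec_def sum_product mult_ac)
  then show ?thesis
    by (simp add: norm_eq_sqrt_inner real_sqrt_mult)
qed

lemma measurable_outer:
  assumes "f \<in> borel_measurable M" "g \<in> borel_measurable M"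
  shows "(\<lambda>x. outer (f x) (g x)) \<in> borel_measurable M"
proof -
  have "continuous_on UNIV (\<lambda>p :: (real ^ 'n) \<times> (real ^ 'n). outer (fst p) (snd p))"
    unfolding outer_def by (intro continuous_intros)
  from borel_measurable_continuous_on[OF this, of "\<lambda>x. (f x, g x)"] show ?thesis
    using assms by simp
qed

lemma set_integral_full:
  fixes g :: "'a \<Rightarrow> 'b :: {banach, second_countable_topology}"
  assumes "AE x in M. x \<in> S" "S \<in> sets M" and g [measurable]: "g \<in> borel_measurable M"
  shows "(LINT x:S|M. g x) = (\<integral>x. g x \<partial>M)"
proof -
  note [measurable] = assms(2)
  show ?thesis
    unfolding set_lebesgue_integral_def
    by (rule integral_cong_AE) (use assms(1) in \<open>auto elim!: eventually_mono\<close>)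
qed

lemma form_var_matrix:
  assumes "prob_space M" and f [measurable]: "f \<in> borel_measurable M"
    and sq: "integrable M (\<lambda>x. (norm (f x))\<^sup>2)"
    and S: "AE x in M. x \<in> S" "S \<in> sets M"
  shows "c \<bullet> (var_matrix M S f *v c) = (\<integral>x. (c \<bullet> f x)\<^sup>2 \<partial>M) - (\<integral>x. c \<bullet> f x \<partial>M)\<^sup>2"
    and "integrable M (\<lambda>x. (c \<bullet> f x)\<^sup>2)"
    and "transpose (var_matrix M S f) = var_matrix M S f"
proof -
  interpret prob_space M by fact
  have mo [measurable]: "(\<lambda>x. outer (f x) (f x)) \<in> borel_measurable M"
    by (intro measurable_outer f)
  have int_outer: "integrable M (\<lambda>x. outer (f x) (f x))"
    by (rule Bochner_Integration.integrable_bound[OF sq mo])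
      (simp add: norm_outer power2_eq_square)
  have int: "integrable M f"
  proof -
    have "integrable M (\<lambda>x. norm (f x))"
      by (rule square_integrable_imp_integrable[OF _ sq]) measurable
    then show ?thesis by (simp add: integrable_norm_iff)
  qed
  let ?A = "\<integral>x. outer (f x) (f x) \<partial>M" and ?m = "\<integral>x. f x \<partial>M"
  have V: "var_matrix M S f = ?A - outer ?m ?m"
    unfolding var_matrix_def by (simp add: set_integral_full[OF S])
  have "c \<bullet> (?A *v c) = (\<integral>x. c \<bullet> (outer (f x) (f x) *v c) \<partial>M)"
    by (rule integral_bounded_linear[OF bounded_linear_form int_outer, symmetric])
  moreover have "(\<integral>x. c \<bullet> f x \<partial>M) = c \<bullet> ?m"
    using int by simp
  ultimately show "c \<bullet> (var_matrix M S f *v c) = (\<integral>x. (c \<bullet> f x)\<^sup>2 \<partial>M) - (\<integral>x. c \<bullet> f x \<partial>M)\<^sup>2"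
    by (simp add: V matrix_vector_mult_diff_rdistrib inner_diff_right form_outer power2_eq_square)
  show "integrable M (\<lambda>x. (c \<bullet> f x)\<^sup>2)"
    using integrable_bounded_linear[OF bounded_linear_form int_outer, of c]
    by (simp add: form_outer power2_eq_square)
  have "transpose ?A = (\<integral>x. transpose (outer (f x) (f x)) \<partial>M)"
    by (rule integral_bounded_linear[OF bounded_linear_transpose int_outer, symmetric])
  then show "transpose (var_matrix M S f) = var_matrix M S f"
    by (simp add: V transpose_outer_self linear_diff[OF linear_transpose])
qed

lemma form_weighted_outer:
  "c \<bullet> (weighted_outer \<rho> Df u x *v c) = (\<Prod>k\<in>u. weight (\<rho> k) (x $ k)) * (c \<bullet> Df u x)\<^sup>2"
  by (simp add: weighted_outer_def scaleR_matrix_vector_assoc[symmetric] form_outer power2_eq_square)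

text \<open>
  For integrable families of positive semi-definite matrices the extended quadratic forms are finite
  and equal to those of the Bochner integrals, so an inequality of forms is a Loewner inequality.
\<close>

lemma loewner_le_of_forms:
  fixes G :: "'k \<Rightarrow> real ^ 'd \<Rightarrow> real ^ 'n ^ 'n"
  assumes fin: "finite K" and a: "\<And>k. k \<in> K \<Longrightarrow> 0 \<le> a k"
    and int: "\<And>k. k \<in> K \<Longrightarrow> set_integrable M S (G k)"
    and psd: "\<And>k x. k \<in> K \<Longrightarrow> psd (G k x)"
    and V: "transpose V = V"
    and le: "quad_form V \<le> (\<lambda>c. \<Sum>k\<in>K. ennreal (a k) * ext_integral_form M S (G k) c)"
  shows "V \<preceq>\<^sub>L (\<Sum>k\<in>K. a k *\<^sub>R (LINT x:S|M. G k x))"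
proof -
  let ?I = "\<lambda>k. LINT x:S|M. G k x" and ?B = "\<Sum>k\<in>K. a k *\<^sub>R (LINT x:S|M. G k x)"
  have int': "integrable M (\<lambda>x. indicator S x *\<^sub>R G k x)" if "k \<in> K" for k
    using int[OF that] by (simp add: set_integrable_def)
  have form_I: "c \<bullet> (?I k *v c) = (\<integral>x. indicator S x * (c \<bullet> (G k x *v c)) \<partial>M)" if "k \<in> K" for k c
    unfolding set_lebesgue_integral_def
    by (subst integral_bounded_linear[OF bounded_linear_form int'[OF that], symmetric])
      (simp add: scaleR_matrix_vector_assoc[symmetric])
  have nonneg: "0 \<le> c \<bullet> (G k x *v c)" if "k \<in> K" for k x c
    using psd[OF that] by (simp add: psd_def)
  have Q: "ext_integral_form M S (G k) c = ennreal (c \<bullet> (?I k *v c))" if "k \<in> K" for k c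
  proof -
    have "ext_integral_form M S (G k) c = (\<integral>\<^sup>+x. ennreal (indicator S x * (c \<bullet> (G k x *v c))) \<partial>M)"
      unfolding ext_integral_form_def quad_form_def
      by (intro nn_integral_cong) (auto simp: indicator_def)
    also have "\<dots> = ennreal (\<integral>x. indicator S x * (c \<bullet> (G k x *v c)) \<partial>M)"
      using integrable_bounded_linear[OF bounded_linear_form int'[OF that], of c] nonneg[OF that]
      by (intro nn_integral_eq_integral) (simp_all add: scaleR_matrix_vector_assoc[symmetric])
    finally show ?thesis by (simp add: form_I that)
  qed
  have I_nonneg: "0 \<le> c \<bullet> (?I k *v c)" if "k \<in> K" for k c
    using nonneg[OF that] by (simp add: form_I that)
  have form_B: "c \<bullet> (?B *v c) = (\<Sum>k\<in>K. a k * (c \<bullet> (?I k *v c)))" for c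
    using linear_sum[OF bounded_linear.linear[OF bounded_linear_form, of c], of "\<lambda>k. a k *\<^sub>R ?I k" K]
    by (simp add: scaleR_matrix_vector_assoc[symmetric])
  have transpose_I: "transpose (?I k) = ?I k" if "k \<in> K" for k
  proof -
    have "transpose (?I k) = (\<integral>x. transpose (indicator S x *\<^sub>R G k x) \<partial>M)"
      unfolding set_lebesgue_integral_def
      by (rule integral_bounded_linear[OF bounded_linear_transpose int'[OF that], symmetric])
    also have "\<dots> = ?I k"
      unfolding set_lebesgue_integral_def
      using psd[OF that] by (simp add: psd_def linear_cmul[OF linear_transpose])
    finally show ?thesis .
  qed
  have transpose_B: "transpose ?B = ?B"
    using linear_sum[OF linear_transpose, of "\<lambda>k. a k *\<^sub>R ?I k" K]
    by (simp add: linear_cmul[OF linear_transpose] transpose_I)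
  have "c \<bullet> (V *v c) \<le> c \<bullet> (?B *v c)" for c
  proof -
    have "ennreal (c \<bullet> (V *v c)) \<le> (\<Sum>k\<in>K. ennreal (a k) * ext_integral_form M S (G k) c)"
      using le by (simp add: le_fun_def quad_form_def)
    also have "\<dots> = (\<Sum>k\<in>K. ennreal (a k * (c \<bullet> (?I k *v c))))"
      by (intro sum.cong refl) (simp add: Q ennreal_mult a I_nonneg)
    also have "\<dots> = ennreal (\<Sum>k\<in>K. a k * (c \<bullet> (?I k *v c)))"
      by (intro sum_ennreal) (simp add: a I_nonneg)
    finally show ?thesis
      unfolding form_B by (subst (asm) ennreal_le_iff) (auto intro!: sum_nonneg mult_nonneg_nonneg a I_nonneg)
  qed
  then show ?thesis
    by (simp add: loewner_le_def psd_def V transpose_B linear_diff[OF linear_transpose]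
        matrix_vector_mult_diff_rdistrib inner_diff_right)
qed

section \<open>Derivative-based bounds for the variance matrix\<close>

lemma distributed_prod_law:
  assumes "prob_space P"
    and indep: "prob_space.indep_vars P (\<lambda>_. borel) (\<lambda>j \<omega>. X \<omega> $ j) UNIV"
    and dens: "\<And>j. distributed P lborel (\<lambda>\<omega>. X \<omega> $ j) (\<lambda>t. ennreal (\<rho> j t))"
  shows "prob_space (marginal (\<rho> j))" and "X \<in> borel_measurable P"
    and "distr P borel X = prod_law \<rho>"
proof -
  interpret prob_space P by fact
  have m [measurable]: "(\<lambda>\<omega>. X \<omega> $ j) \<in> borel_measurable P" for j
    using distributed_measurable[OF dens] by simp
  show X [measurable]: "X \<in> borel_measurable P"
    by (rule measurable_vecI) measurable
  have marg: "distr P borel (\<lambda>\<omega>. X \<omega> $ j) = marginal (\<rho> j)" for j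
    using distributed_distr_eq_density[OF dens[of j]]
    by (simp add: marginal_def cong: distr_cong)
  show "prob_space (marginal (\<rho> j))"
    unfolding marg[symmetric] by (rule prob_space_distr) measurable
  have "distr P (\<Pi>\<^sub>M j\<in>UNIV. borel) (\<lambda>\<omega>. \<lambda>j\<in>UNIV. X \<omega> $ j) = (\<Pi>\<^sub>M j\<in>UNIV. marginal (\<rho> j))"
    using indep_vars_iff_distr_eq_PiM[of UNIV "\<lambda>j \<omega>. X \<omega> $ j" "\<lambda>_. borel"] indep m
    by (simp add: marg)
  then have "prod_law \<rho> = distr (distr P (\<Pi>\<^sub>M j\<in>UNIV. borel) (\<lambda>\<omega>. \<lambda>j\<in>UNIV. X \<omega> $ j)) borel (\<lambda>y. \<chi> j. y j)"
    by (simp add: prod_law_def)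
  also have "\<dots> = distr P borel ((\<lambda>y. \<chi> j. y j) \<circ> (\<lambda>\<omega>. \<lambda>j\<in>UNIV. X \<omega> $ j))"
    by (rule distr_distr) (auto intro!: measurable_vecI)
  also have "((\<lambda>y. \<chi> j. y j) \<circ> (\<lambda>\<omega>. \<lambda>j\<in>UNIV. X \<omega> $ j)) = X"
    by (simp add: fun_eq_iff vec_eq_iff)
  finally show "distr P borel X = prod_law \<rho>" by simp
qed

lemma has_cross_partial_empty: "has_cross_partial f {} g \<Longrightarrow> g = f"
  by (erule has_cross_partial.cases) auto

text \<open>
  The last differentiation must have been in \<open>j\<close>, and before it nothing had been differentiated.
\<close>

lemma has_cross_partial_singleton:
  assumes "has_cross_partial f {j} g"
  shows "((\<lambda>t. f (upd_coord x j t)) has_vector_derivative g x) (at (x $ j))"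
  using assms
proof cases
  case (insert v g' i)
  then have "v = {}" "i = j" by auto
  with insert has_cross_partial_empty[of f g'] show ?thesis by auto
qed auto

text \<open>
  The singleton \<open>{j}\<close> belongs to no super-set of another variable, so it survives the removal of
  those super-sets unless the first-order derivative itself vanishes.
\<close>

lemma interaction_superset_difference_empty:
  assumes empty: "interaction_superset Df j - (\<Union>i\<in>I. interaction_superset Df i) = {}" and "j \<notin> I"
  shows "Df {j} = (\<lambda>x. 0)"
proof (rule ccontr)
  assume "Df {j} \<noteq> (\<lambda>x. 0)"
  then have "{j} \<in> interaction_superset Df j"
    by (auto simp: interaction_superset_def)
  moreover have "{j} \<notin> interaction_superset Df i" if "i \<in> I" for i
    using that \<open>j \<notin> I\<close> by (auto simp: interaction_superset_def)
  ultimately show False using empty by auto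
qed

theorem theorem3p4:
  fixes P :: "'a measure"
    and X :: "'a \<Rightarrow> real ^ 'd"
    and \<rho> :: "'d \<Rightarrow> real \<Rightarrow> real"
    and \<Omega> :: "'d \<Rightarrow> real set"
    and f :: "real ^ 'd \<Rightarrow> real ^ 'n"
    and Df :: "'d set \<Rightarrow> real ^ 'd \<Rightarrow> real ^ 'n"
  defines "S \<equiv> box_of \<Omega>"
    and "\<mu> \<equiv> prod_law \<rho>"
    and "G \<equiv> weighted_outer \<rho> Df"
    and "V \<equiv> var_matrix (prod_law \<rho>) (box_of \<Omega>) f"
    and "D \<equiv> (\<lambda>j. LINT x:box_of \<Omega>|prod_law \<rho>. weighted_outer \<rho> Df {j} x)"
    and "Q \<equiv> (\<lambda>u. ext_integral_form (prod_law \<rho>) (box_of \<Omega>) (weighted_outer \<rho> Df u))"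
    and "\<A> \<equiv> interaction_superset Df"
  assumes "prob_space P"
    and "prob_space.indep_vars P (\<lambda>_. borel) (\<lambda>j \<omega>. X \<omega> $ j) UNIV"
    and "\<And>j. distributed P lborel (\<lambda>\<omega>. X \<omega> $ j) (\<lambda>t. ennreal (\<rho> j t))"
    and "\<And>j. open (\<Omega> j)" and "\<And>j. is_interval (\<Omega> j)"
    and "\<And>j. continuous_on (\<Omega> j) (\<rho> j)"
    and "\<And>j t. t \<in> \<Omega> j \<Longrightarrow> \<rho> j t > 0"
    and "\<And>j t. t \<notin> \<Omega> j \<Longrightarrow> \<rho> j t = 0"
    and "f \<in> borel_measurable borel"
    and "integrable P (\<lambda>\<omega>. (norm (f (X \<omega>)))\<^sup>2)"
    and "\<And>v. has_cross_partial f v (Df v)"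
    and "\<And>v. Df v \<in> borel_measurable borel"
    and "\<And>v. integrable P (\<lambda>\<omega>. (norm (Df v (X \<omega>)))\<^sup>2)"
  shows
    "\<comment> \<open>(i)\<close>
     (((\<forall>u. card u > 0 \<longrightarrow> set_integrable \<mu> S (G u))
         \<longrightarrow> V \<preceq>\<^sub>L (\<Sum>u | card u > 0. (1 / 2 ^ card u) *\<^sub>R (LINT x:S|\<mu>. G u x)))
      \<and> quad_form V \<le> (\<lambda>c. \<Sum>u | card u > 0. ennreal (1 / 2 ^ card u) * Q u c))
     \<and>
     \<comment> \<open>(ii)\<close>
     (\<forall>J0. J0 \<noteq> {} \<and> (\<forall>j\<in>J0. AE x in \<mu>. (LINT t:\<Omega> j|marginal (\<rho> j). f (upd_coord x j t)) = 0) \<longrightarrow>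
       ((\<forall>j\<in>J0. set_integrable \<mu> S (G {j}))
         \<longrightarrow> (\<forall>m. loewner_argmin D J0 m \<longrightarrow> V \<preceq>\<^sub>L (1 / 2) *\<^sub>R D m))
       \<and> (\<forall>m. is_arg_min (\<lambda>j. Q {j}) (\<lambda>j. j \<in> J0) m
             \<longrightarrow> quad_form V \<le> (\<lambda>c. ennreal (1 / 2) * Q {m} c)))
     \<and>
     \<comment> \<open>(iii)\<close>
     (\<forall>\<sigma> :: nat \<Rightarrow> 'd.
       ((\<forall>j. set_integrable \<mu> S (G {j}))
           \<and> (\<forall>j\<in>{1..CARD('d)}. loewner_argmin D (UNIV - \<sigma> ` {1..<j}) (\<sigma> j))
         \<longrightarrow> V \<preceq>\<^sub>L (\<Sum>j = 1..CARD('d).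
               (real (card (\<A> (\<sigma> j) - (\<Union>i\<in>\<sigma> ` {1..<j}. \<A> i))) / 2) *\<^sub>R D (\<sigma> j)))
       \<and> ((\<forall>j\<in>{1..CARD('d)}. is_arg_min (\<lambda>k. Q {k}) (\<lambda>k. k \<in> UNIV - \<sigma> ` {1..<j}) (\<sigma> j))
         \<longrightarrow> quad_form V \<le> (\<lambda>c. \<Sum>j = 1..CARD('d).
               ennreal (real (card (\<A> (\<sigma> j) - (\<Union>i\<in>\<sigma> ` {1..<j}. \<A> i))) / 2) * Q {\<sigma> j} c)))"
proof -
  note indep = assms(9) and dens = assms(10) and interval = assms(12) and pos = assms(14) and zero = assms(15)
    and f [measurable] = assms(16) and Df = assms(18) and Df_meas [measurable] = assms(19)
  note law = distributed_prod_law[OF assms(8) indep dens]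
  note prob = law(1)
  have \<mu>: "\<mu> = distr P borel X" by (simp add: \<mu>_def law(3))
  have sets [measurable_cong]: "sets \<mu> = sets borel" by (simp add: \<mu>)
  interpret P: prob_space P by (rule assms(8))
  interpret \<mu>: prob_space \<mu>
    unfolding \<mu> by (rule P.prob_space_distr[OF law(2)])
  have f_sq: "integrable \<mu> (\<lambda>x. (norm (f x))\<^sup>2)"
  proof -
    have "(\<lambda>x. (norm (f x))\<^sup>2) \<in> borel_measurable borel" by measurable
    then show ?thesis
      using assms(17) by (simp add: \<mu> integrable_distr_eq[OF law(2)])
  qed
  have \<rho>_meas [measurable]: "\<rho> j \<in> borel_measurable borel" for j
  proof -
    have "(\<lambda>t. enn2real (ennreal (\<rho> j t))) \<in> borel_measurable borel"
      using distributed_borel_measurable[OF dens[of j]] by simp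
    moreover have "enn2real (ennreal (\<rho> j t)) = \<rho> j t" for t
      using pos[of t j] zero[of t j] by (cases "t \<in> \<Omega> j") auto
    ultimately show ?thesis by simp
  qed
  have \<Omega>_full: "AE t in marginal (\<rho> j). t \<in> \<Omega> j" for j
  proof -
    have "t \<in> \<Omega> j" if "0 < ennreal (\<rho> j t)" for t
      using that zero[of t j] by (cases "t \<in> \<Omega> j") auto
    then show ?thesis
      unfolding marginal_def by (subst AE_density) auto
  qed
  have \<Omega>_sets: "\<Omega> j \<in> sets (marginal (\<rho> j))" for j
    using assms(11)[of j] by (simp add: marginal_def)
  have S_sets: "S \<in> sets \<mu>"
  proof -
    have "S = (\<Inter>j. (\<lambda>x. x $ j) -` \<Omega> j \<inter> space borel)"
      by (auto simp: S_def box_of_def)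
    also have "\<dots> \<in> sets borel"
      using assms(11) by (intro sets.finite_INT measurable_sets[OF borel_measurable_nth]) auto
    finally show ?thesis by (simp add: sets)
  qed
  have S_full: "AE x in \<mu>. x \<in> S"
  proof -
    have "AE x in \<mu>. x $ j \<in> \<Omega> j" for j
    proof -
      have "AE y in (\<Pi>\<^sub>M j\<in>UNIV. marginal (\<rho> j)). y j \<in> \<Omega> j"
        by (rule AE_PiM_component[OF prob UNIV_I \<Omega>_full])
      moreover have "{x :: real ^ 'd. x $ j \<in> \<Omega> j} \<in> sets borel"
        using measurable_sets[OF borel_measurable_nth, of "\<Omega> j" j] assms(11)[of j] by (simp add: vimage_def)
      ultimately show ?thesis
        unfolding \<mu>_def prod_law_def
        by (subst AE_distr_iff[OF measurable_vec_of_fun]) auto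
    qed
    then show ?thesis
      by (simp add: S_def box_of_def AE_all_countable)
  qed
  note V_form = form_var_matrix[OF \<mu>.prob_space_axioms _ f_sq S_full S_sets, folded V_def[folded \<mu>_def S_def]]
  have V_sym: "transpose V = V" by (rule V_form(3)) measurable
  have sq_form: "integrable \<mu> (\<lambda>x. (c \<bullet> f x)\<^sup>2)" for c
    by (rule V_form(2)) measurable
  have V_gap: "2 * quad_form V c = sq_gap \<mu> (\<lambda>x. c \<bullet> f x)" for c
  proof -
    have "sq_gap \<mu> (\<lambda>x. c \<bullet> f x) = ennreal (2 * (c \<bullet> (V *v c)))"
      by (subst V_form(1), measurable) (rule sq_gap_eq_variance[OF \<mu>.prob_space_axioms _ sq_form], measurable)
    then show ?thesis by (simp add: quad_form_def ennreal_mult')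
  qed
  have G_psd: "psd (G u x)" for u x
  proof -
    have "transpose (G u x) = G u x"
      by (simp add: G_def weighted_outer_def transpose_outer_self linear_cmul[OF linear_transpose])
    moreover have "0 \<le> c \<bullet> (G u x *v c)" for c
      by (simp add: G_def form_weighted_outer prod_nonneg weight_nonneg prob)
    ultimately show ?thesis by (simp add: psd_def)
  qed

  have T_le_Q: "(\<integral>\<^sup>+x. sq_gap (marginal (\<rho> j)) (\<lambda>t. c \<bullet> f (upd_coord x j t)) \<partial>\<mu>) \<le> Q {j} c" for j c
  proof -
    have "(\<integral>\<^sup>+x. sq_gap (marginal (\<rho> j)) (\<lambda>t. c \<bullet> f (upd_coord x j t)) \<partial>\<mu>)
        \<le> (\<integral>\<^sup>+x. ennreal (weight (\<rho> j) (x $ j) * (c \<bullet> Df {j} x)\<^sup>2) \<partial>\<mu>)"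
      unfolding \<mu>_def
    proof (rule sq_gap_coord_le_derivative[OF prob \<rho>_meas _ _ interval pos zero])
      show "(\<lambda>x. c \<bullet> Df {j} x) \<in> borel_measurable borel" by measurable
      show "((\<lambda>t. c \<bullet> f (upd_coord x j t)) has_real_derivative c \<bullet> Df {j} x) (at (x $ j))" for x
        unfolding has_real_derivative_iff_has_vector_derivative
        by (rule bounded_linear.has_vector_derivative[OF bounded_linear_inner_right
              has_cross_partial_singleton[OF Df]])
    qed
    also have "\<dots> = Q {j} c"
      unfolding Q_def ext_integral_form_def quad_form_def form_weighted_outer \<mu>_def[symmetric] S_def[symmetric]
      using S_full by (intro nn_integral_cong_AE) (auto elim!: eventually_mono)
    finally show ?thesis .
  qed

  have halve: "ennreal (1 / 2) * (2 * a) = a" for a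
  proof -
    have "ennreal (1 / 2 * 2) = ennreal (1 / 2) * ennreal 2" by (rule ennreal_mult') simp
    then have "ennreal (1 / 2) * 2 = 1" by simp
    then show ?thesis by (simp only: mult.assoc[symmetric] mult_1)
  qed
  \<comment> \<open>The common source of all three parts: the variance is at most half the sum of the \<open>Q {j}\<close>.\<close>
  have first_order: "quad_form V c \<le> (\<Sum>j\<in>UNIV. ennreal (1 / 2) * Q {j} c)" for c
  proof -
    have "2 * quad_form V c \<le> (\<Sum>j\<in>UNIV. Q {j} c)"
      unfolding V_gap \<mu>_def
      by (rule order_trans[OF efron_stein_prod_law[OF prob] sum_mono[OF T_le_Q[unfolded \<mu>_def]]]) measurable
    from mult_left_mono[OF this, of "ennreal (1 / 2)"] show ?thesis
      by (simp only: halve sum_distrib_left zero_le)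
  qed
  have loewnerI: "V \<preceq>\<^sub>L (\<Sum>k\<in>K. a k *\<^sub>R (LINT x:S|\<mu>. G (u k) x))"
    if "finite K" "\<And>k. k \<in> K \<Longrightarrow> 0 \<le> a k" "\<And>k. k \<in> K \<Longrightarrow> set_integrable \<mu> S (G (u k))"
      "quad_form V \<le> (\<lambda>c. \<Sum>k\<in>K. ennreal (a k) * Q (u k) c)"
    for K :: "'k set" and a and u :: "'k \<Rightarrow> 'd set"
    using that G_psd V_sym
    by (intro loewner_le_of_forms) (simp_all add: Q_def G_def \<mu>_def S_def)
  have D: "D j = (LINT x:S|\<mu>. G {j} x)" for j
    by (simp add: D_def S_def \<mu>_def G_def)

  have forms_i: "quad_form V \<le> (\<lambda>c. \<Sum>u | card u > 0. ennreal (1 / 2 ^ card u) * Q u c)"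
  proof (rule le_funI)
    fix c
    have "(\<Sum>j\<in>UNIV. ennreal (1 / 2) * Q {j} c)
        = (\<Sum>u\<in>range (\<lambda>j. {j}). ennreal (1 / 2 ^ card u) * Q u c)"
      by (subst sum.reindex) (auto simp: inj_on_def)
    also have "\<dots> \<le> (\<Sum>u | card u > 0. ennreal (1 / 2 ^ card u) * Q u c)"
      by (rule sum_mono2) auto
    finally show "quad_form V c \<le> \<dots>"
      using first_order[of c] by (rule order_trans[rotated])
  qed
  have loewner_i: "V \<preceq>\<^sub>L (\<Sum>u | card u > 0. (1 / 2 ^ card u) *\<^sub>R (LINT x:S|\<mu>. G u x))"
    if "\<forall>u. card u > 0 \<longrightarrow> set_integrable \<mu> S (G u)"
    using that by (intro loewnerI forms_i) auto
  {
    fix J0 m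
    assume J0: "\<forall>j\<in>J0. AE x in \<mu>. (LINT t:\<Omega> j|marginal (\<rho> j). f (upd_coord x j t)) = 0" and m: "m \<in> J0"
    have "quad_form V c \<le> ennreal (1 / 2) * Q {m} c" for c
    proof -
      \<comment> \<open>On almost every line \<open>f\<close> is integrable, so that the inner product with \<open>c\<close> commutes with the integral.\<close>
      have zero_c: "AE x in \<mu>. (\<integral>t. c \<bullet> f (upd_coord x m t) \<partial>marginal (\<rho> m)) = 0"
        using J0[rule_format, OF m] AE_square_integrable_coord[OF prob f f_sq[unfolded \<mu>_def], of m, folded \<mu>_def]
      proof eventually_elim
        case (elim x)
        interpret m: prob_space "marginal (\<rho> m)" by (rule prob)
        have [measurable_cong]: "sets (marginal (\<rho> m)) = sets borel" by (simp add: marginal_def)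
        have meas [measurable]: "(\<lambda>t. f (upd_coord x m t)) \<in> borel_measurable (marginal (\<rho> m))"
          by measurable
        have "integrable (marginal (\<rho> m)) (\<lambda>t. norm (f (upd_coord x m t)))"
          by (rule m.square_integrable_imp_integrable[OF _ elim(2)]) measurable
        then have "integrable (marginal (\<rho> m)) (\<lambda>t. f (upd_coord x m t))"
          by (simp add: integrable_norm_iff)
        moreover have "(\<integral>t. f (upd_coord x m t) \<partial>marginal (\<rho> m)) = 0"
          using elim(1) by (simp add: set_integral_full[OF \<Omega>_full \<Omega>_sets meas])
        ultimately show ?case by simp
      qed
      have "2 * quad_form V c \<le> 2 * (\<integral>\<^sup>+x. ennreal ((c \<bullet> f x)\<^sup>2) \<partial>\<mu>)"
        unfolding quad_form_def nn_integral_eq_integral[OF sq_form, simplified]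
        by (intro mult_left_mono ennreal_leI) (simp_all add: V_form(1))
      also have "\<dots> = (\<integral>\<^sup>+x. sq_gap (marginal (\<rho> m)) (\<lambda>t. c \<bullet> f (upd_coord x m t)) \<partial>\<mu>)"
        using zero_c sq_form[of c] unfolding \<mu>_def
        by (intro second_moment_eq_sq_gap_coord prob) measurable
      also have "\<dots> \<le> Q {m} c" by (rule T_le_Q)
      finally show ?thesis
        using mult_left_mono[of "2 * quad_form V c" "Q {m} c" "ennreal (1 / 2)"]
        by (simp only: halve zero_le)
    qed
  } note forms_ii = this
  {
    fix \<sigma> :: "nat \<Rightarrow> 'd"
    assume \<sigma>: "\<And>j. j \<in> {1..CARD('d)} \<Longrightarrow> \<sigma> j \<in> UNIV - \<sigma> ` {1..<j}"
    \<comment> \<open>Every index is chosen among those not yet used, so all of them occur exactly once.\<close>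
    have inj: "inj_on \<sigma> {1..CARD('d)}"
    proof (rule linorder_inj_onI')
      fix i j assume ij: "i \<in> {1..CARD('d)}" "j \<in> {1..CARD('d)}" "i < j"
      then have "\<sigma> i \<in> \<sigma> ` {1..<j}" by (intro imageI) simp
      with \<sigma>[OF ij(2)] show "\<sigma> i \<noteq> \<sigma> j" by (metis DiffD2)
    qed
    have "\<sigma> ` {1..CARD('d)} = UNIV"
      using card_image[OF inj] by (intro card_subset_eq) simp_all
    with inj have bij: "bij_betw \<sigma> {1..CARD('d)} UNIV" by (simp add: bij_betw_def)
    \<comment> \<open>Each coefficient is at least \<open>1/2\<close>, or else \<open>Q {\<sigma> j}\<close> vanishes.\<close>
    have "quad_form V \<le> (\<lambda>c. \<Sum>j = 1..CARD('d).
               ennreal (real (card (\<A> (\<sigma> j) - (\<Union>i\<in>\<sigma> ` {1..<j}. \<A> i))) / 2) * Q {\<sigma> j} c)"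
    proof (rule le_funI)
      fix c
      have "quad_form V c \<le> (\<Sum>j = 1..CARD('d). ennreal (1 / 2) * Q {\<sigma> j} c)"
        using first_order[of c] by (simp add: sum.reindex_bij_betw[OF bij, symmetric])
      also have "\<dots> \<le> (\<Sum>j = 1..CARD('d).
               ennreal (real (card (\<A> (\<sigma> j) - (\<Union>i\<in>\<sigma> ` {1..<j}. \<A> i))) / 2) * Q {\<sigma> j} c)"
      proof (rule sum_mono)
        fix j assume j: "j \<in> {1..CARD('d)}"
        let ?n = "card (\<A> (\<sigma> j) - (\<Union>i\<in>\<sigma> ` {1..<j}. \<A> i))"
        show "ennreal (1 / 2) * Q {\<sigma> j} c \<le> ennreal (real ?n / 2) * Q {\<sigma> j} c"
        proof (cases "?n = 0")
          case True
          then have "\<A> (\<sigma> j) - (\<Union>i\<in>\<sigma> ` {1..<j}. \<A> i) = {}"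
            by (simp only: card_0_eq finite)
          moreover have "\<sigma> j \<notin> \<sigma> ` {1..<j}"
            using \<sigma>[OF j] by (simp only: Diff_iff simp_thms)
          ultimately have "Df {\<sigma> j} = (\<lambda>x. 0)"
            unfolding \<A>_def by (rule interaction_superset_difference_empty)
          then have "Q {\<sigma> j} c = 0"
            by (simp add: Q_def ext_integral_form_def quad_form_def form_weighted_outer)
          then show ?thesis by simp
        next
          case False
          then have "1 / 2 \<le> real ?n / 2" by linarith
          then show ?thesis by (rule mult_right_mono[OF ennreal_leI zero_le])
        qed
      qed
      finally show "quad_form V c \<le> \<dots>" .
    qed
  } note forms_iii = this
  show ?thesis
  proof (intro conjI allI impI)
    fix J0 m
    assume J0: "J0 \<noteq> {} \<and> (\<forall>j\<in>J0. AE x in \<mu>. (LINT t:\<Omega> j|marginal (\<rho> j). f (upd_coord x j t)) = 0)"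
    show "V \<preceq>\<^sub>L (1 / 2) *\<^sub>R D m"
      if "\<forall>j\<in>J0. set_integrable \<mu> S (G {j})" "loewner_argmin D J0 m"
    proof -
      have m: "m \<in> J0" using that(2) by (simp add: loewner_argmin_def)
      have "V \<preceq>\<^sub>L (\<Sum>k\<in>{m}. (1 / 2) *\<^sub>R (LINT x:S|\<mu>. G {k} x))"
        using that(1) m forms_ii[OF conjunct2[OF J0] m] by (intro loewnerI) (auto intro!: le_funI)
      then show ?thesis by (simp add: D)
    qed
    show "quad_form V \<le> (\<lambda>c. ennreal (1 / 2) * Q {m} c)"
      if "is_arg_min (\<lambda>j. Q {j}) (\<lambda>j. j \<in> J0) m"
      using that by (intro le_funI forms_ii[OF conjunct2[OF J0]]) (simp add: is_arg_min_def)
  next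
    fix \<sigma> :: "nat \<Rightarrow> 'd"
    assume "(\<forall>j. set_integrable \<mu> S (G {j}))
      \<and> (\<forall>j\<in>{1..CARD('d)}. loewner_argmin D (UNIV - \<sigma> ` {1..<j}) (\<sigma> j))"
    then show "V \<preceq>\<^sub>L (\<Sum>j = 1..CARD('d).
        (real (card (\<A> (\<sigma> j) - (\<Union>i\<in>\<sigma> ` {1..<j}. \<A> i))) / 2) *\<^sub>R D (\<sigma> j))"
      unfolding D by (intro loewnerI forms_iii) (auto simp: loewner_argmin_def)
  next
    fix \<sigma> :: "nat \<Rightarrow> 'd"
    assume "\<forall>j\<in>{1..CARD('d)}. is_arg_min (\<lambda>k. Q {k}) (\<lambda>k. k \<in> UNIV - \<sigma> ` {1..<j}) (\<sigma> j)"
    then show "quad_form V \<le> (\<lambda>c. \<Sum>j = 1..CARD('d).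
        ennreal (real (card (\<A> (\<sigma> j) - (\<Union>i\<in>\<sigma> ` {1..<j}. \<A> i))) / 2) * Q {\<sigma> j} c)"
      by (intro forms_iii) (auto simp: is_arg_min_def)
  qed (use forms_i loewner_i in simp_all)
qed

end
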